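(* Let $w$ be a 321-avoiding permutation and let $\sigma(w)=\eta/\tau$ be the skew Young diagram with flagging $f_w$ corresponding to $w$ via the Billey-Jockusch-Stanley bijection. The Grothendieck polynomial $\mathfrak{G}_w(x)=\mathfrak{G}_w(x,0)$ is equal to $$\sum_{T\in FSVT(\sigma(w),f_w)}\beta^{|T|-|\sigma(w)|}x^T.$$
   Context: A permutation $w$ is 321-avoiding if there are no $a<b<c$ with $w(a)>w(b)>w(c)$. Let $f_w=(f_1<\cdots<f_t)$ be the increasing sequence of indices $j$ with $w(j)>j$, and let $e_i=w(f_i)-1$. Put $p_i=f_{t+1-i}$, $q_i=e_{t+1-i}$, $\lambda_i=q_i-t+i$, $\mu_i=p_i-(t+1-i)$ for $1\le i\le t$. The skew shape $\sigma(w)=\eta/\tau$ is given by $\eta_i=\lambda_1-\mu_{t+1-i}$ and $\tau_i=\lambda_1-\lambda_{t+1-i}$ (the $180$-degree rotation of $\lambda/\mu$), so row $i$ has $e_i-f_i+1$ boxes; $|\sigma(w)|$ is its number of boxes. A set-valued tableau of skew shape $\eta/\tau$ is a labelling of its boxes by finite nonempty subsets of the positive integers such that the maximum of the label of any box $(i,j)$ is at most the minimum of the label at $(i,j+1)$ and smaller than the minimum of the label at $(i+1,j)$. $FSVT(\eta/\tau,f)$ is the set of set-valued tableaux of shape $\eta/\tau$ in which every label in row $i$ is a subset of $\{1,\dots,f_i\}$. For such $T$, $x^T$ is the monomial in which the exponent of $x_i$ is the number of boxes whose label contains $i$, and $|T|$ is the total degree of $x^T$. Grothendieck polynomials $\mathfrak{G}_w(x)$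 (with parameter $\beta$): for the longest element $w_0\in S_n$, $\mathfrak{G}_{w_0}=\prod_{i=1}^{n-1} x_i^{n-i}$; if $w(i)>w(i+1)$, then $\mathfrak{G}_{ws_i}=\frac{(1+\beta x_{i+1})\mathfrak{G}_w-(1+\beta x_i)s_i\mathfrak{G}_w}{x_i-x_{i+1}}$, where $s_i$ exchanges $x_i$ and $x_{i+1}$. *)

theory Defs
  imports
    "HOL-Library.Poly_Mapping"
    "HOL-Computational_Algebra.Polynomial"
    "HOL-Combinatorics.Permutations"
begin

section \<open>Polynomials in infinitely many variables\<close>

text \<open>
  Polynomials in \<open>x\<^sub>1, x\<^sub>2, \<dots>\<close> over \<open>\<int>[\<beta>]\<close>. A monomial is the finitely supported function
  of its exponents; the coefficient ring \<open>\<int>[\<beta>]\<close> is \<open>int poly\<close>, so \<open>\<beta>\<close> is an indeterminate.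
\<close>

type_synonym monom = "nat \<Rightarrow>\<^sub>0 nat"
type_synonym xpoly = "monom \<Rightarrow>\<^sub>0 int poly"

definition monomial :: "monom \<Rightarrow> xpoly" where
  "monomial m = Poly_Mapping.single m 1"

definition X :: "nat \<Rightarrow> xpoly" where
  "X i = monomial (Poly_Mapping.single i 1)"

definition \<beta> :: xpoly where
  "\<beta> = Poly_Mapping.single 0 [:0, 1:]"

definition total_degree :: "monom \<Rightarrow> nat" where
  "total_degree m = (\<Sum>i\<in>Poly_Mapping.keys m. Poly_Mapping.lookup m i)"

text \<open>
  The polynomial \<open>s\<^sub>i P\<close>: its coefficient at a monomial is the coefficient of \<open>P\<close> at the monomial
  with the exponents of \<open>x\<^sub>i\<close> and \<open>x\<^bsub>i+1\<^esub>\<close> exchanged.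
\<close>

definition swap_vars :: "nat \<Rightarrow> xpoly \<Rightarrow> xpoly" where
  "swap_vars i P = Poly_Mapping.map_key (Poly_Mapping.map_key (transpose i (i + 1))) P"

lemma inj_map_key_transpose:
  "inj (Poly_Mapping.map_key (transpose i j) :: ('a \<Rightarrow>\<^sub>0 'b::zero) \<Rightarrow> _)"
proof (rule injI)
  fix m m' :: "'a \<Rightarrow>\<^sub>0 'b"
  assume eq: "Poly_Mapping.map_key (transpose i j) m = Poly_Mapping.map_key (transpose i j) m'"
  have t: "inj (transpose i j)" by simp
  have "Poly_Mapping.lookup m (transpose i j k) = Poly_Mapping.lookup m' (transpose i j k)" for k
    using arg_cong[OF eq, of "\<lambda>p. Poly_Mapping.lookup p k"] by (simp add: map_key.rep_eq[OF t])
  from this[of "transpose i j _"] show "m = m'"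
    by (intro poly_mapping_eqI) simp
qed

lemma lookup_swap_vars:
  "Poly_Mapping.lookup (swap_vars i P) m =
     Poly_Mapping.lookup P (Poly_Mapping.map_key (transpose i (i + 1)) m)"
  unfolding swap_vars_def by (simp add: map_key.rep_eq[OF inj_map_key_transpose])

lemma swap_vars_X: "swap_vars i (X j) = X (transpose i (i + 1) j)"
proof -
  let ?s = "transpose i (i + 1)"
  have s: "inj ?s" by simp
  have *: "Poly_Mapping.map_key ?s (Poly_Mapping.single (?s j) (1::nat)) = Poly_Mapping.single j 1"
    by (rule map_key_single[OF s])
  show ?thesis
    unfolding swap_vars_def X_def monomial_def *[symmetric]
    by (rule map_key_single[OF inj_map_key_transpose])
qed


section \<open>Grothendieck polynomials\<close>

text \<open>Elements of \<open>S\<^sub>n\<close> are functions \<open>w\<close> on \<open>nat\<close> with \<open>w permutes {1..n}\<close>.\<close>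

definition longest_perm :: "nat \<Rightarrow> nat \<Rightarrow> nat" where
  "longest_perm n i = (if i \<in> {1..n} then n + 1 - i else i)"

text \<open>
  The recursion is recorded as a relation, because every descent of \<open>w\<close> may be used in a step. The
  division by \<open>x\<^sub>i - x\<^bsub>i+1\<^esub>\<close> is expressed by an equation for the quotient \<open>Q\<close>, which is unique as
  polynomials form an integral domain.
\<close>

inductive is_grothendieck :: "nat \<Rightarrow> (nat \<Rightarrow> nat) \<Rightarrow> xpoly \<Rightarrow> bool" for n :: nat where
  longest: "is_grothendieck n (longest_perm n) (\<Prod>i=1..n-1. X i ^ (n - i))"
| step: "is_grothendieck n w P \<Longrightarrow> 1 \<le> i \<Longrightarrow> i < n \<Longrightarrow> w i > w (i + 1) \<Longrightarrow>
    (X i - X (i + 1)) * Q = (1 + \<beta> * X (i + 1)) * P - (1 + \<beta> * X i) * swap_vars i P \<Longrightarrow>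
    is_grothendieck n (w \<circ> transpose i (i + 1)) Q"

definition grothendieck :: "nat \<Rightarrow> (nat \<Rightarrow> nat) \<Rightarrow> xpoly" where
  "grothendieck n w = (THE P. is_grothendieck n w P)"


section \<open>Flagged set-valued tableaux of skew shape\<close>

text \<open>
  A skew shape \<open>\<eta>/\<tau>\<close> with rows \<open>1, \<dots>, t\<close>. Box \<open>(i, j)\<close> lies in row \<open>i\<close> and column \<open>j\<close>.
\<close>

definition skew_diagram :: "nat \<Rightarrow> (nat \<Rightarrow> int) \<Rightarrow> (nat \<Rightarrow> int) \<Rightarrow> (nat \<times> int) set" where
  "skew_diagram t \<eta> \<tau> = {(i, j). i \<in> {1..t} \<and> \<tau> i < j \<and> j \<le> \<eta> i}"

text \<open>
  Labellings are functions on all of \<open>nat \<times> int\<close>; requiring the empty label outside the diagram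
  makes them correspond bijectively to the labellings of the boxes.
\<close>

definition SVT :: "(nat \<times> int) set \<Rightarrow> (nat \<times> int \<Rightarrow> nat set) set" where
  "SVT D = {T.
     (\<forall>b. b \<notin> D \<longrightarrow> T b = {}) \<and>
     (\<forall>b\<in>D. finite (T b) \<and> T b \<noteq> {} \<and> (\<forall>k\<in>T b. 1 \<le> k)) \<and>
     (\<forall>i j. (i, j) \<in> D \<and> (i, j + 1) \<in> D \<longrightarrow> Max (T (i, j)) \<le> Min (T (i, j + 1))) \<and>
     (\<forall>i j. (i, j) \<in> D \<and> (i + 1, j) \<in> D \<longrightarrow> Max (T (i, j)) < Min (T (i + 1, j)))}"

definition FSVT :: "(nat \<times> int) set \<Rightarrow> (nat \<Rightarrow> nat) \<Rightarrow> (nat \<times> int \<Rightarrow> nat set) set" where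
  "FSVT D f = {T \<in> SVT D. \<forall>i j. (i, j) \<in> D \<longrightarrow> T (i, j) \<subseteq> {1..f i}}"

definition exponents :: "(nat \<times> int) set \<Rightarrow> (nat \<times> int \<Rightarrow> nat set) \<Rightarrow> monom" where
  "exponents D T = Abs_poly_mapping (\<lambda>k. card {b \<in> D. k \<in> T b})"

lemma finite_skew_diagram: "finite (skew_diagram t \<eta> \<tau>)"
proof -
  have "skew_diagram t \<eta> \<tau> = (SIGMA i:{1..t}. {\<tau> i<..\<eta> i})"
    by (auto simp: skew_diagram_def)
  then show ?thesis by simp
qed

lemma finite_FSVT:
  assumes "finite D"
  shows "finite (FSVT D f)"
proof -
  let ?B = "\<Union>b\<in>D. {1..f (fst b)}"
  have "FSVT D f \<subseteq> {T. \<forall>b. (b \<in> D \<longrightarrow> T b \<in> Pow ?B) \<and> (b \<notin> D \<longrightarrow> T b = {})}"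
  proof (intro subsetI CollectI allI)
    fix T b assume T: "T \<in> FSVT D f"
    have "T b \<subseteq> {1..f (fst b)}" if "b \<in> D"
      using T that by (cases b) (simp add: FSVT_def)
    moreover have "T b = {}" if "b \<notin> D"
      using T that by (cases b) (simp add: FSVT_def SVT_def)
    ultimately show "(b \<in> D \<longrightarrow> T b \<in> Pow ?B) \<and> (b \<notin> D \<longrightarrow> T b = {})"
      by blast
  qed
  moreover have "finite {T. \<forall>b. (b \<in> D \<longrightarrow> T b \<in> Pow ?B) \<and> (b \<notin> D \<longrightarrow> T b = {})}"
    by (rule finite_set_of_finite_funs) (use assms in auto)
  ultimately show ?thesis by (rule finite_subset)
qed

lemma lookup_exponents:
  assumes "finite D" and "T \<in> SVT D"
  shows "Poly_Mapping.lookup (exponents D T) k = card {b \<in> D. k \<in> T b}"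
proof -
  have "{k. card {b \<in> D. k \<in> T b} \<noteq> 0} \<subseteq> (\<Union>b\<in>D. T b)"
  proof
    fix k assume "k \<in> {k. card {b \<in> D. k \<in> T b} \<noteq> 0}"
    then have "{b \<in> D. k \<in> T b} \<noteq> {}" by (simp add: card_eq_0_iff)
    then show "k \<in> (\<Union>b\<in>D. T b)" by blast
  qed
  moreover have "finite (\<Union>b\<in>D. T b)"
    using assms by (auto simp: SVT_def)
  ultimately have "finite {k. card {b \<in> D. k \<in> T b} \<noteq> 0}"
    by (rule finite_subset)
  then show ?thesis
    unfolding exponents_def by (rule lookup_Abs_poly_mapping[THEN fun_cong])
qed


section \<open>The flagged skew shape of a 321-avoiding permutation\<close>

definition avoids_321 :: "(nat \<Rightarrow> nat) \<Rightarrow> bool" where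
  "avoids_321 w \<longleftrightarrow> \<not> (\<exists>a b c. a < b \<and> b < c \<and> w a > w b \<and> w b > w c)"

definition excedances :: "(nat \<Rightarrow> nat) \<Rightarrow> nat list" where
  "excedances w = sorted_list_of_set {j. w j > j}"

definition num_rows :: "(nat \<Rightarrow> nat) \<Rightarrow> nat" where
  "num_rows w = length (excedances w)"

text \<open>
  All sequences are indexed from 1, and values that are defined by subtraction are integers.
\<close>

definition flag :: "(nat \<Rightarrow> nat) \<Rightarrow> nat \<Rightarrow> nat" where
  "flag w i = excedances w ! (i - 1)"

definition e_seq :: "(nat \<Rightarrow> nat) \<Rightarrow> nat \<Rightarrow> int" where
  "e_seq w i = int (w (flag w i)) - 1"

definition p_seq :: "(nat \<Rightarrow> nat) \<Rightarrow> nat \<Rightarrow> int" where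
  "p_seq w i = int (flag w (num_rows w + 1 - i))"

definition q_seq :: "(nat \<Rightarrow> nat) \<Rightarrow> nat \<Rightarrow> int" where
  "q_seq w i = e_seq w (num_rows w + 1 - i)"

definition lam :: "(nat \<Rightarrow> nat) \<Rightarrow> nat \<Rightarrow> int" where
  "lam w i = q_seq w i - int (num_rows w) + int i"

definition mu :: "(nat \<Rightarrow> nat) \<Rightarrow> nat \<Rightarrow> int" where
  "mu w i = p_seq w i - (int (num_rows w) + 1 - int i)"

definition eta :: "(nat \<Rightarrow> nat) \<Rightarrow> nat \<Rightarrow> int" where
  "eta w i = lam w 1 - mu w (num_rows w + 1 - i)"

definition tau :: "(nat \<Rightarrow> nat) \<Rightarrow> nat \<Rightarrow> int" where
  "tau w i = lam w 1 - lam w (num_rows w + 1 - i)"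

definition skew_shape :: "(nat \<Rightarrow> nat) \<Rightarrow> (nat \<times> int) set" where
  "skew_shape w = skew_diagram (num_rows w) (eta w) (tau w)"

lemma row_length:
  assumes "i \<in> {1..num_rows w}"
  shows "eta w i - tau w i = e_seq w i - int (flag w i) + 1"
  using assms by (simp add: eta_def tau_def lam_def mu_def p_seq_def q_seq_def)

end

theory Submission
  imports Defs
begin

text \<open>
  In the 0-Hecke algebra with \<open>u\<^sub>i\<^sup>2 = \<beta> u\<^sub>i\<close>, the product over \<open>k = 1, \<dots>, n - 1\<close> of the rows
  \<open>(1 + x\<^sub>k u\<^bsub>n-1\<^esub>) \<dots> (1 + x\<^sub>k u\<^sub>k)\<close> has the Grothendieck polynomials as coefficients (Fomin and
  Kirillov): rows that end in the same generator commute, which makes the product times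
  \<open>1 + x\<^bsub>i+1\<^esub> u\<^sub>i\<close> symmetric in \<open>x\<^sub>i, x\<^bsub>i+1\<^esub>\<close>, and this symmetry is the divided difference
  recursion. If \<open>w\<close> avoids 321, the coefficient at \<open>w\<close> is expanded one factor at a time from the
  right: the factor \<open>1 + x\<^sub>k u\<^sub>j\<close> decides whether the label \<open>k\<close> occurs on the diagonal \<open>j\<close>, where it
  can only sit in the corner box given by a descent of \<open>w\<close> at \<open>j\<close>. The flag condition becomes the
  condition \<open>k \<le> j\<close> on the pairs \<open>(k, j)\<close> that have a factor.
\<close>

section \<open>Exchanging variables is a ring homomorphism\<close>

text \<open>Polynomials are finite sums of terms, so multiplicativity of \<open>swap_vars\<close>
  only has to be checked on terms.\<close>

lemma xpoly_induct [case_names zero single add]: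
  fixes P :: xpoly
  assumes "Q 0" and "\<And>m c. Q (Poly_Mapping.single m c)"
    and "\<And>P P'. Q P \<Longrightarrow> Q P' \<Longrightarrow> Q (P + P')"
  shows "Q P"
proof (induction P rule: update_induct)
  case const
  show ?case by (rule assms(1))
next
  case (update f a b)
  have "Poly_Mapping.update a b f = f + Poly_Mapping.single a b"
    using update(1)
    by (intro poly_mapping_eqI) (auto simp: lookup_update lookup_add lookup_single in_keys_iff when_def)
  then show ?case using assms(2,3) update by metis
qed

lemma swap_vars_add: "swap_vars i (P + Q) = swap_vars i P + swap_vars i Q"
  by (intro poly_mapping_eqI) (simp add: lookup_swap_vars lookup_add)

lemma swap_vars_zero [simp]: "swap_vars i 0 = 0"
  by (intro poly_mapping_eqI) (simp add: lookup_swap_vars)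

lemma map_key_transpose_involutory:
  "Poly_Mapping.map_key (transpose i j) (Poly_Mapping.map_key (transpose i j) m) = m"
  by (intro poly_mapping_eqI) (simp add: map_key.rep_eq)

lemma swap_vars_single:
  "swap_vars i (Poly_Mapping.single m c) =
    Poly_Mapping.single (Poly_Mapping.map_key (transpose i (i + 1)) m) c"
proof -
  have "swap_vars i (Poly_Mapping.single
      (Poly_Mapping.map_key (transpose i (i + 1)) (Poly_Mapping.map_key (transpose i (i + 1)) m)) c) =
    Poly_Mapping.single (Poly_Mapping.map_key (transpose i (i + 1)) m) c"
    unfolding swap_vars_def by (rule map_key_single[OF inj_map_key_transpose])
  then show ?thesis by (simp only: map_key_transpose_involutory)
qed

lemma swap_vars_mult: "swap_vars i (P * Q) = swap_vars i P * swap_vars i Q"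
proof (induction P rule: xpoly_induct)
  case zero
  show ?case by simp
next
  case (single m c)
  show ?case
  proof (induction Q rule: xpoly_induct)
    case (single m' c')
    show ?case
      by (simp add: mult_single swap_vars_single map_key_plus del: One_nat_def)
  qed (simp_all add: swap_vars_add distrib_left)
qed (simp_all add: swap_vars_add distrib_right)

lemma swap_vars_one [simp]: "swap_vars i 1 = 1"
  by (metis swap_vars_single map_key_zero inj_transpose single_one)

lemma swap_vars_beta [simp]: "swap_vars i \<beta> = \<beta>"
  by (simp add: \<beta>_def swap_vars_single)

lemma X_eq_iff: "X i = X j \<longleftrightarrow> i = j"
proof
  assume "X i = X j"
  then have "Poly_Mapping.keys (X i) = Poly_Mapping.keys (X j)" by simp
  then have "Poly_Mapping.single i (1::nat) = Poly_Mapping.single j 1"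
    by (simp add: X_def monomial_def)
  then have "Poly_Mapping.keys (Poly_Mapping.single i (1::nat)) = Poly_Mapping.keys (Poly_Mapping.single j (1::nat))"
    by simp
  then show "i = j" by simp
qed simp


section \<open>The 0-Hecke algebra acting on functions of permutations\<close>

text \<open>
  Writing \<open>F\<close> for the formal sum \<open>\<Sum>w. F w u\<^sub>w\<close>, \<open>hecke i\<close> is right multiplication by the generator
  \<open>u\<^sub>i\<close> with \<open>u\<^sub>i\<^sup>2 = \<beta> u\<^sub>i\<close>, \<open>hfactor i x\<close> right multiplication by \<open>1 + x u\<^sub>i\<close>, and \<open>row n i x\<close> right
  multiplication by \<open>(1 + x u\<^bsub>n-1\<^esub>) \<dots> (1 + x u\<^sub>i)\<close>.
\<close>

definition hecke :: "nat \<Rightarrow> ((nat \<Rightarrow> nat) \<Rightarrow> xpoly) \<Rightarrow> (nat \<Rightarrow> nat) \<Rightarrow> xpoly" where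
  "hecke i F w = (if w (Suc i) < w i then F (w \<circ> transpose i (Suc i)) + \<beta> * F w else 0)"

definition hfactor :: "nat \<Rightarrow> xpoly \<Rightarrow> ((nat \<Rightarrow> nat) \<Rightarrow> xpoly) \<Rightarrow> (nat \<Rightarrow> nat) \<Rightarrow> xpoly" where
  "hfactor i x F w = F w + x * hecke i F w"

definition row :: "nat \<Rightarrow> nat \<Rightarrow> xpoly \<Rightarrow> ((nat \<Rightarrow> nat) \<Rightarrow> xpoly) \<Rightarrow> (nat \<Rightarrow> nat) \<Rightarrow> xpoly" where
  "row n i x F = foldr (\<lambda>j. hfactor j x) [i..<n] F"

lemma comp_transpose_transpose [simp]: "w \<circ> transpose i j \<circ> transpose i j = w"
  by (auto simp: fun_eq_iff)

lemma hecke_add: "hecke i (\<lambda>w. F w + G w) = (\<lambda>w. hecke i F w + hecke i G w)"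
  by (simp add: hecke_def fun_eq_iff algebra_simps)

lemma hecke_scale: "hecke i (\<lambda>w. x * F w) = (\<lambda>w. x * hecke i F w)"
  by (simp add: hecke_def fun_eq_iff algebra_simps)

lemma hecke_hecke: "hecke i (hecke i F) w = \<beta> * hecke i F w"
  by (auto simp: hecke_def)

lemma comp_transpose_commute:
  assumes "Suc i < j"
  shows "w \<circ> transpose i (Suc i) \<circ> transpose j (Suc j) = w \<circ> transpose j (Suc j) \<circ> transpose i (Suc i)"
  using assms by (auto simp: fun_eq_iff transpose_def)

lemma hecke_commute:
  assumes "Suc i < j"
  shows "hecke i (hecke j F) w = hecke j (hecke i F) w"
  using assms comp_transpose_commute[OF assms, of w]
  by (auto simp: hecke_def transpose_def algebra_simps)

lemma comp_transpose_braid: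
  "w \<circ> transpose i (Suc i) \<circ> transpose (Suc i) (Suc (Suc i)) \<circ> transpose i (Suc i) =
   w \<circ> transpose (Suc i) (Suc (Suc i)) \<circ> transpose i (Suc i) \<circ> transpose (Suc i) (Suc (Suc i))"
  by (auto simp: fun_eq_iff transpose_def)

lemma hecke_braid:
  "hecke i (hecke (Suc i) (hecke i F)) w = hecke (Suc i) (hecke i (hecke (Suc i) F)) w"
proof -
  have "(w \<circ> transpose i (Suc i)) i = w (Suc i)" "(w \<circ> transpose i (Suc i)) (Suc i) = w i"
    "(w \<circ> transpose i (Suc i)) (Suc (Suc i)) = w (Suc (Suc i))"
    "(w \<circ> transpose (Suc i) (Suc (Suc i))) i = w i"
    "(w \<circ> transpose (Suc i) (Suc (Suc i))) (Suc i) = w (Suc (Suc i))"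
    "(w \<circ> transpose (Suc i) (Suc (Suc i))) (Suc (Suc i)) = w (Suc i)" for w :: "nat \<Rightarrow> nat"
    by (auto simp: transpose_def)
  note vals = this
  show ?thesis
    using comp_transpose_braid[of w i]
    by (simp add: hecke_def vals del: comp_apply) (auto simp: algebra_simps)
qed

lemma hfactor_commute:
  assumes "Suc i < j"
  shows "hfactor i x (hfactor j y F) = hfactor j y (hfactor i x F)"
proof
  fix w
  have "hfactor i x F = (\<lambda>w. F w + x * hecke i F w)" for i x F
    by (simp add: hfactor_def fun_eq_iff)
  then show "hfactor i x (hfactor j y F) w = hfactor j y (hfactor i x F) w"
    by (simp add: hecke_add hecke_scale hecke_commute[OF assms] algebra_simps)
qed

lemma hfactor_commute_same: "hfactor i x (hfactor i y F) = hfactor i y (hfactor i x F)"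
proof
  fix w
  have "hfactor i x F = (\<lambda>w. F w + x * hecke i F w)" for i x F
    by (simp add: hfactor_def fun_eq_iff)
  then show "hfactor i x (hfactor i y F) w = hfactor i y (hfactor i x F) w"
    by (simp add: hecke_add hecke_scale algebra_simps)
qed

text \<open>This is the inductive step of \<open>row_commute\<close>: \<open>F\<close> and
  \<open>G\<close> stand for the two orders of multiplying in parts of two rows, and the hypothesis
  says that they agree once both rows reach down to the generator \<open>Suc i\<close>.\<close>

lemma hfactor_exchange:
  assumes eq: "hfactor (Suc i) y F = hfactor (Suc i) x G"
  shows "hfactor i y (hfactor (Suc i) y (hfactor i x F)) =
    hfactor i x (hfactor (Suc i) x (hfactor i y G))"
proof
  fix w
  let ?a = "hecke (Suc i)" and ?b = "hecke i"
  have hf: "hfactor i x F = (\<lambda>w. F w + x * hecke i F w)" for i x F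
    by (simp add: hfactor_def fun_eq_iff)
  have expand: "hfactor i y (hfactor (Suc i) y (hfactor i x F)) w =
      F w + (x + y + \<beta> * x * y) * ?b F w + y * ?a F w + x * y * ?a (?b F) w
      + y * y * ?b (?a F) w + x * y * y * ?b (?a (?b F)) w" for x y F
    by (simp add: hf hecke_add hecke_scale hecke_hecke algebra_simps)
  have lin: "F w + y * ?a F w = G w + x * ?a G w" for w
    using fun_cong[OF eq] by (simp add: hfactor_def)
  then have lin': "(\<lambda>w. F w + y * ?a F w) = (\<lambda>w. G w + x * ?a G w)" by (rule ext)
  have op: "h (\<lambda>w. F w + y * ?a F w) w = h (\<lambda>w. G w + x * ?a G w) w" for h :: "_ \<Rightarrow> (nat \<Rightarrow> nat) \<Rightarrow> xpoly" and w
    by (simp add: lin')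
  have 1: "?b F w + y * ?b (?a F) w = ?b G w + x * ?b (?a G) w"
    using op[of ?b w] by (simp add: hecke_add hecke_scale)
  have 2: "?a (?b F) w + y * ?a (?b (?a F)) w = ?a (?b G) w + x * ?a (?b (?a G)) w"
    using op[of "\<lambda>F. ?a (?b F)" w] by (simp add: hecke_add hecke_scale)
  have 3: "(1 + \<beta> * y) * ?b (?a F) w = (1 + \<beta> * x) * ?b (?a G) w"
    using op[of "\<lambda>F. ?b (?a F)" w] by (simp add: hecke_add hecke_scale hecke_hecke algebra_simps)
  \<comment> \<open>By the braid relation, the claim is \<open>lin\<close>, plus
    \<open>x + y + \<beta> * x * y\<close> times \<open>1\<close>, plus \<open>x * y\<close> times
    \<open>2\<close>, minus \<open>x * y\<close> times \<open>3\<close>.\<close>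
  show "hfactor i y (hfactor (Suc i) y (hfactor i x F)) w =
    hfactor i x (hfactor (Suc i) x (hfactor i y G)) w"
    unfolding expand hecke_braid using lin[of w] 1 2 3 by algebra
qed

lemma row_unfold: "i < n \<Longrightarrow> row n i x F = hfactor i x (row n (Suc i) x F)"
  by (simp add: row_def upt_conv_Cons)

lemma row_empty [simp]: "n \<le> i \<Longrightarrow> row n i x F = F"
  by (simp add: row_def)

lemma hfactor_row_commute:
  assumes "Suc i < k"
  shows "hfactor i x (row n k y F) = row n k y (hfactor i x F)"
proof (cases "k \<le> n")
  case True
  then show ?thesis using assms
  proof (induction rule: inc_induct)
    case (step k)
    then show ?case by (simp add: row_unfold hfactor_commute[of i k])
  qed simp
qed simp

text \<open>Downward induction on \<open>i\<close>. The last factor of the inner row moves past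
  every factor of the outer row with index above \<open>Suc i\<close>; the induction hypothesis then
  supplies the premise of \<open>hfactor_exchange\<close>.\<close>

lemma row_commute: "row n i x (row n i y F) = row n i y (row n i x F)"
proof (cases "i \<le> n")
  case True
  then show ?thesis
  proof (induction rule: inc_induct)
    case (step i)
    show ?case
    proof (cases "Suc i < n")
      case True
      let ?F = "row n (Suc (Suc i)) y (row n (Suc i) x F)"
      let ?G = "row n (Suc (Suc i)) x (row n (Suc i) y F)"
      have "hfactor (Suc i) y ?F = hfactor (Suc i) x ?G"
        using step.IH True by (simp add: row_unfold[of "Suc i"])
      from hfactor_exchange[OF this] show ?thesis
        using step True by (simp add: row_unfold hfactor_row_commute)
    next
      case False
      then show ?thesis using step by (simp add: row_unfold hfactor_commute_same)
    qed
  qed simp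
qed simp

text \<open>The start is the unit of the algebra. The row with number \<open>n\<close> is empty, so
  \<open>row_prod n n\<close> is the full product over \<open>k = 1, ..., n - 1\<close>.\<close>

primrec row_prod :: "nat \<Rightarrow> nat \<Rightarrow> (nat \<Rightarrow> nat) \<Rightarrow> xpoly" where
  "row_prod n 0 = (\<lambda>w. if w = id then 1 else 0)"
| "row_prod n (Suc m) = row n (Suc m) (X (Suc m)) (row_prod n m)"


section \<open>Grothendieck polynomials as coefficients in the 0-Hecke algebra\<close>

lemma swap_vars_hfactor:
  "(\<lambda>w. swap_vars i (hfactor j x F w)) = hfactor j (swap_vars i x) (\<lambda>w. swap_vars i (F w))"
  by (simp add: fun_eq_iff hfactor_def hecke_def swap_vars_add swap_vars_mult)

lemma swap_vars_row:
  "(\<lambda>w. swap_vars i (row n k x F w)) = row n k (swap_vars i x) (\<lambda>w. swap_vars i (F w))"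
proof (cases "k \<le> n")
  case True
  then show ?thesis
    by (induction rule: inc_induct) (simp_all add: row_unfold swap_vars_hfactor)
qed simp

lemma swap_vars_row_prod_lower: "m < i \<Longrightarrow> (\<lambda>w. swap_vars i (row_prod n m w)) = row_prod n m"
proof (induction m)
  case 0
  then show ?case by (simp add: fun_eq_iff)
next
  case (Suc m)
  then show ?case by (simp add: swap_vars_row swap_vars_X transpose_def)
qed

text \<open>The extra factor extends row \<open>Suc i\<close> to end in the same generator as row
  \<open>i\<close>, so exchanging the variables only changes the order of two commuting rows. Later
  rows contain neither variable, and the extra factor commutes with them.\<close>

lemma swap_vars_hfactor_row_prod:
  assumes "1 \<le> i" "i < n" "Suc i \<le> m"
  shows "(\<lambda>w. swap_vars i (hfactor i (X (Suc i)) (row_prod n m) w)) =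
    hfactor i (X (Suc i)) (row_prod n m)"
  using assms(3)
proof (induction rule: dec_induct)
  case base
  obtain k where k: "i = Suc k" using assms(1) by (cases i) auto
  have "hfactor i (X (Suc i)) (row_prod n (Suc i)) =
      row n i (X (Suc i)) (row n i (X i) (row_prod n k))"
    using assms(2) by (simp add: k row_unfold)
  moreover have "(\<lambda>w. swap_vars i (row n i (X (Suc i)) (row n i (X i) (row_prod n k)) w)) =
      row n i (X i) (row n i (X (Suc i)) (row_prod n k))"
    using swap_vars_row_prod_lower[of k i n] by (simp add: swap_vars_row swap_vars_X k)
  ultimately show ?case by (simp add: row_commute)
next
  case (step m)
  then show ?case
    by (simp add: hfactor_row_commute swap_vars_row swap_vars_X transpose_def)
qed

text \<open>Compare coefficients in the symmetry of
  \<open>hfactor i (X (Suc i)) (row_prod n n)\<close>. At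
  \<open>w \<circ> transpose i (Suc i)\<close>, which ascends at \<open>i\<close>, it shows that the
  coefficient of \<open>row_prod\<close> is symmetric; inserted into the comparison at
  \<open>w\<close>, this gives the recursion.\<close>

lemma row_prod_divided_difference:
  assumes "1 \<le> i" "i < n" "w (Suc i) < w i"
  shows "(X i - X (Suc i)) * row_prod n n (w \<circ> transpose i (Suc i)) =
    (1 + \<beta> * X (Suc i)) * row_prod n n w - (1 + \<beta> * X i) * swap_vars i (row_prod n n w)"
proof -
  let ?G = "row_prod n n" and ?v = "w \<circ> transpose i (Suc i)"
  have *: "swap_vars i (hfactor i (X (Suc i)) ?G u) = hfactor i (X (Suc i)) ?G u" for u
    using fun_cong[OF swap_vars_hfactor_row_prod[of i n n], of u] assms by simp
  have "swap_vars i (?G ?v) = ?G ?v"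
    using *[of ?v] assms(3) by (simp add: hfactor_def hecke_def)
  moreover have "swap_vars i (?G w) + X i * (swap_vars i (?G ?v) + \<beta> * swap_vars i (?G w)) =
      ?G w + X (Suc i) * (?G ?v + \<beta> * ?G w)"
    using *[of w] assms(3)
    by (simp add: hfactor_def hecke_def swap_vars_add swap_vars_mult swap_vars_X)
  ultimately show ?thesis by (simp add: algebra_simps)
qed

section \<open>Counting inversions, and the coefficient at the longest permutation\<close>

definition inversions :: "nat \<Rightarrow> (nat \<Rightarrow> nat) \<Rightarrow> (nat \<times> nat) set" where
  "inversions n w = {(a, b). 1 \<le> a \<and> a < b \<and> b \<le> n \<and> w b < w a}"

lemma finite_inversions [simp]: "finite (inversions n w)"
  by (rule finite_subset[of _ "{1..n} \<times> {1..n}"]) (auto simp: inversions_def)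

lemma card_inversions_transpose_le:
  assumes "1 \<le> i" "i < n"
  shows "card (inversions n w) \<le> Suc (card (inversions n (w \<circ> transpose i (Suc i))))"
proof -
  let ?s = "transpose i (Suc i)"
  have "inversions n w \<subseteq> insert (i, Suc i) (map_prod ?s ?s ` inversions n (w \<circ> ?s))"
  proof
    fix q assume q: "q \<in> inversions n w"
    show "q \<in> insert (i, Suc i) (map_prod ?s ?s ` inversions n (w \<circ> ?s))"
    proof (cases "q = (i, Suc i)")
      case False
      obtain a b where ab: "q = (a, b)" by (cases q)
      with q False have "1 \<le> ?s a" "?s a < ?s b" "?s b \<le> n"
        using assms by (auto simp: inversions_def transpose_def)
      with q ab have "map_prod ?s ?s q \<in> inversions n (w \<circ> ?s)"
        by (simp add: inversions_def)
      moreover have "q = map_prod ?s ?s (map_prod ?s ?s q)"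
        by (cases q) simp
      ultimately show ?thesis by blast
    qed simp
  qed
  then have "card (inversions n w) \<le> card (insert (i, Suc i) (map_prod ?s ?s ` inversions n (w \<circ> ?s)))"
    by (intro card_mono) auto
  also have "\<dots> \<le> Suc (card (map_prod ?s ?s ` inversions n (w \<circ> ?s)))"
    by (rule card_insert_le_m1) auto
  also have "\<dots> \<le> Suc (card (inversions n (w \<circ> ?s)))"
    by (simp add: card_image_le)
  finally show ?thesis .
qed

text \<open>Each factor raises the number of inversions by at most one, so a product vanishes at
  permutations with more inversions than it has factors.\<close>

lemma hfactor_eq_0:
  assumes "1 \<le> i" "i < n" "\<And>w. N < card (inversions n w) \<Longrightarrow> F w = 0"
    and "Suc N < card (inversions n w)"
  shows "hfactor i x F w = 0"
proof -
  have "F w = 0" using assms(3,4) by simp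
  moreover have "F (w \<circ> transpose i (Suc i)) = 0"
    using assms(3,4) card_inversions_transpose_le[OF assms(1,2), of w] by simp
  ultimately show ?thesis by (simp add: hfactor_def hecke_def)
qed

lemma row_eq_0:
  assumes "1 \<le> k" "k \<le> n" "\<And>w. N < card (inversions n w) \<Longrightarrow> F w = 0"
    and "N + (n - k) < card (inversions n w)"
  shows "row n k x F w = 0"
  using assms(2,1,4)
proof (induction arbitrary: w rule: inc_induct)
  case base
  then show ?case using assms(3) by simp
next
  case (step k)
  have "hfactor k x (row n (Suc k) x F) w = 0"
    by (rule hfactor_eq_0[where n = n and N = "N + (n - Suc k)"]) (use step in auto)
  then show ?case using step by (simp add: row_unfold)
qed

lemma row_prod_eq_0:
  assumes "m \<le> n" "(\<Sum>l=1..m. n - l) < card (inversions n w)"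
  shows "row_prod n m w = 0"
  using assms
proof (induction m arbitrary: w)
  case 0
  have "inversions n id = {}" by (auto simp: inversions_def)
  with 0 show ?case by auto
next
  case (Suc m)
  have "row n (Suc m) (X (Suc m)) (row_prod n m) w = 0"
    by (rule row_eq_0[where N = "\<Sum>l=1..m. n - l"]) (use Suc in auto)
  then show ?case by simp
qed

text \<open>
  The permutations met on the way down from the longest one, when the factors of \<open>row_prod\<close> are
  taken off from the right and every factor contributes a descent: in one-line notation
  \<open>n, \<dots>, n+2-m\<close> followed by \<open>1, \<dots>, n-m\<close> with the value \<open>n+1-m\<close> inserted at position \<open>k\<close>.
\<close>

definition stair_perm :: "nat \<Rightarrow> nat \<Rightarrow> nat \<Rightarrow> nat \<Rightarrow> nat" where
  "stair_perm n m k p =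
    (if 1 \<le> p \<and> p < m then n + 1 - p else if m \<le> p \<and> p < k then p + 1 - m
     else if p = k then n + 1 - m else if k < p \<and> p \<le> n then p - m else p)"

lemma card_inversions_stair_perm:
  assumes "1 \<le> m" "m \<le> k" "k \<le> n"
  shows "(\<Sum>l=1..m-1. n - l) + (n - k) \<le> card (inversions n (stair_perm n m k))"
proof -
  let ?A = "Sigma {1..m-1} (\<lambda>a. {a<..n})" and ?B = "{k} \<times> {k<..n}"
  have "stair_perm n m k b < stair_perm n m k a" if "1 \<le> a" "a < m" "a < b" "b \<le> n" for a b
  proof -
    have "stair_perm n m k a = n + 1 - a" using that by (simp add: stair_perm_def)
    moreover have "stair_perm n m k b < n + 1 - a"
      using that assms by (auto simp: stair_perm_def)
    ultimately show ?thesis by simp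
  qed
  moreover have "stair_perm n m k b < stair_perm n m k k" if "k < b" "b \<le> n" for b
    using that assms by (simp add: stair_perm_def)
  ultimately have "?A \<union> ?B \<subseteq> inversions n (stair_perm n m k)"
    using assms by (auto simp: inversions_def)
  then have "card (?A \<union> ?B) \<le> card (inversions n (stair_perm n m k))"
    by (intro card_mono) auto
  moreover have "card (?A \<union> ?B) = card ?A + card ?B"
    using assms by (intro card_Un_disjoint) auto
  ultimately show ?thesis by (simp add: card_cartesian_product)
qed

text \<open>The permutation has more inversions than the factors before the last one can produce. So
  the last factor must contribute its generator and an \<open>x\<close>, which moves the inserted
  value one position to the right.\<close>

lemma row_stair_perm:
  assumes "Suc m \<le> k" "k \<le> n"
  shows "row n k x (row_prod n m) (stair_perm n (Suc m) k) =
    x ^ (n - k) * row_prod n m (stair_perm n (Suc m) n)"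
  using assms(2,1)
proof (induction rule: inc_induct)
  case base
  show ?case by simp
next
  case (step k)
  let ?F = "row n (Suc k) x (row_prod n m)" and ?z = "stair_perm n (Suc m) k"
  have 0: "?F ?z = 0"
    by (rule row_eq_0[where N = "\<Sum>l=1..m. n - l"])
      (use step card_inversions_stair_perm[of "Suc m" k n] in \<open>auto intro: row_prod_eq_0\<close>)
  have "?z \<circ> transpose k (Suc k) = stair_perm n (Suc m) (Suc k)"
    using step by (auto simp: fun_eq_iff stair_perm_def transpose_def)
  moreover have "?z (Suc k) < ?z k"
    using step by (auto simp: stair_perm_def)
  moreover have "n - k = Suc (n - Suc k)" using step by simp
  ultimately show ?case
    using step 0 by (simp add: row_unfold hfactor_def hecke_def algebra_simps)
qed

lemma row_prod_stair_perm:
  assumes "m < n"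
  shows "row_prod n m (stair_perm n (Suc m) n) = (\<Prod>l=1..m. X l ^ (n - l))"
  using assms
proof (induction m)
  case 0
  have "stair_perm n (Suc 0) n = id"
    using 0 by (auto simp: fun_eq_iff stair_perm_def)
  then show ?case by (simp add: id_def)
next
  case (Suc m)
  \<comment> \<open>The leftmost insertion of one stage is the rightmost insertion of the
    next.\<close>
  have "stair_perm n (Suc (Suc m)) n = stair_perm n (Suc m) (Suc m)"
    using Suc.prems by (auto simp: fun_eq_iff stair_perm_def)
  then show ?case
    using Suc row_stair_perm[of m "Suc m" n "X (Suc m)"] by (simp add: mult.commute)
qed

lemma row_prod_longest_perm: "row_prod n n (longest_perm n) = (\<Prod>i=1..n-1. X i ^ (n - i))"
proof (cases n)
  case 0
  then show ?thesis by (auto simp: fun_eq_iff longest_perm_def)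
next
  case (Suc m)
  have "longest_perm n = stair_perm n (Suc m) n"
    using Suc by (auto simp: fun_eq_iff stair_perm_def longest_perm_def)
  then show ?thesis using row_prod_stair_perm[of m n] by (simp add: Suc)
qed

section \<open>Uniqueness and existence of the polynomials given by the recursion\<close>

lemma is_grothendieck_unique:
  assumes "is_grothendieck n w P"
  shows "P = row_prod n n w"
  using assms
proof induction
  case longest
  show ?case by (rule row_prod_longest_perm[symmetric])
next
  case (step w P i Q)
  \<comment> \<open>\<open>row_prod\<close> satisfies the recursion at every descent, so all chains
    of descents from the longest permutation lead to the same polynomial.\<close>
  then have "(X i - X (Suc i)) * Q = (X i - X (Suc i)) * row_prod n n (w \<circ> transpose i (Suc i))"
    by (simp add: row_prod_divided_difference)
  moreover have "X i - X (Suc i) \<noteq> 0" by (simp add: X_eq_iff)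
  ultimately show ?case by (metis mult_left_cancel Suc_eq_plus1)
qed

lemma decreasing_perm_eq_longest:
  assumes w: "w permutes {1..n}" and dec: "\<And>i. 1 \<le> i \<Longrightarrow> i < n \<Longrightarrow> w (Suc i) < w i"
  shows "w = longest_perm n"
proof
  fix i
  show "w i = longest_perm n i"
  proof (cases "i \<in> {1..n}")
    case True
    have range: "1 \<le> w p \<and> w p \<le> n" if "p \<in> {1..n}" for p
      using permutes_in_image[OF w, of p] that by simp
    have "w i + (i - 1) \<le> n"
      using True
    proof (induction i)
      case (Suc i)
      then show ?case using dec[of i] range[of "Suc i"] by (cases "i = 0") auto
    qed simp
    moreover have "n + 1 \<le> w i + i"
      using True[unfolded atLeastAtMost_iff, THEN conjunct2] True[unfolded atLeastAtMost_iff, THEN conjunct1]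
    proof (induction rule: inc_induct)
      case base
      then show ?case using range[of n] by simp
    next
      case (step i)
      then show ?case using dec[of i] by auto
    qed
    ultimately show ?thesis using True by (simp add: longest_perm_def)
  next
    case False
    then show ?thesis using permutes_not_in[OF w] by (auto simp: longest_perm_def)
  qed
qed

lemma is_grothendieck_row_prod:
  assumes "w permutes {1..n}"
  shows "is_grothendieck n w (row_prod n n w)"
  using assms
\<comment> \<open>Swapping the two values at an ascent lowers this sum. The induction thus climbs to
  the longest permutation, the only one without ascents.\<close>
proof (induction "\<Sum>p=1..n. p * w p" arbitrary: w rule: less_induct)
  case less
  show ?case
  proof (cases "\<forall>i. 1 \<le> i \<and> i < n \<longrightarrow> w (Suc i) < w i")
    case True
    then have "w = longest_perm n"
      using decreasing_perm_eq_longest[OF less.prems] by blast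
    then show ?thesis using is_grothendieck.longest[of n] row_prod_longest_perm by simp
  next
    case False
    then obtain i where i: "1 \<le> i" "i < n" "\<not> w (Suc i) < w i" by blast
    moreover have "w (Suc i) \<noteq> w i"
      using permutes_inj[OF less.prems] by (simp add: inj_eq)
    ultimately have asc: "w i < w (Suc i)" by simp
    let ?s = "transpose i (Suc i)"
    have perm: "w \<circ> ?s permutes {1..n}"
      using i by (intro permutes_compose permutes_swap_id less.prems) auto
    let ?R = "{1..n} - {i, Suc i}"
    have split: "(\<Sum>p=1..n. f p) = f i + f (Suc i) + sum f ?R" for f :: "nat \<Rightarrow> nat"
    proof -
      have "sum f ({i, Suc i} \<union> ?R) = sum f {i, Suc i} + sum f ?R"
        by (rule sum.union_disjoint) auto
      moreover have "{i, Suc i} \<union> ?R = {1..n}" using i by auto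
      ultimately show ?thesis by simp
    qed
    have "(\<Sum>p\<in>?R. p * (w \<circ> ?s) p) = (\<Sum>p\<in>?R. p * w p)"
      by (intro sum.cong) (auto simp: transpose_def)
    then have "(\<Sum>p=1..n. p * (w \<circ> ?s) p) < (\<Sum>p=1..n. p * w p)"
      using asc unfolding split by (simp add: algebra_simps)
    then have "is_grothendieck n (w \<circ> ?s) (row_prod n n (w \<circ> ?s))"
      using less.hyps perm by blast
    from is_grothendieck.step[OF this i(1,2), of "row_prod n n (w \<circ> ?s \<circ> ?s)"]
    show ?thesis
      using row_prod_divided_difference[OF i(1,2), of "w \<circ> ?s"] asc by simp
  qed
qed

lemma grothendieck_eq_row_prod:
  assumes "w permutes {1..n}"
  shows "grothendieck n w = row_prod n n w"
  unfolding grothendieck_def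
  using is_grothendieck_row_prod[OF assms] is_grothendieck_unique by (intro the_equality) blast+


section \<open>Descents of 321-avoiding permutations\<close>

text \<open>Pigeonhole, counting from 0. No entry before \<open>j\<close> exceeds
  \<open>w j\<close>, and no value below \<open>w (Suc j)\<close> stands after \<open>Suc j\<close>,
  since either would complete a 321 pattern with the descent.\<close>

lemma descent_321_avoiding:
  assumes bij: "bij w" and av: "avoids_321 w" and desc: "w (Suc j) < w j"
  shows "j < w j" and "w (Suc j) \<le> j"
proof -
  have inj: "inj w" using bij by (rule bij_is_inj)
  show "j < w j"
  proof (rule ccontr)
    assume "\<not> j < w j"
    have "w a < w j" if "a < j" for a
    proof (rule ccontr)
      assume "\<not> w a < w j"
      moreover have "w a \<noteq> w j" using inj that by (simp add: inj_eq)
      ultimately show False using av that desc unfolding avoids_321_def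
        by (metis lessI linorder_neqE_nat)
    qed
    then have "w ` insert (Suc j) {..<j} \<subseteq> {..<w j}" using desc by auto
    from card_mono[OF _ this] have "Suc j \<le> w j"
      using card_image[OF inj_on_subset[OF inj subset_UNIV], of "insert (Suc j) {..<j}"] by simp
    with \<open>\<not> j < w j\<close> show False by simp
  qed
  show "w (Suc j) \<le> j"
  proof -
    have "{..<w (Suc j)} \<subseteq> w ` {..<j}"
    proof
      fix v assume v: "v \<in> {..<w (Suc j)}"
      obtain p where p: "v = w p" using bij by (metis bij_pointE)
      have "\<not> Suc j < p"
        using av v desc unfolding avoids_321_def p by (metis lessI lessThan_iff)
      moreover have "p \<noteq> Suc j" "p \<noteq> j" using v desc p by auto
      ultimately show "v \<in> w ` {..<j}" using p by auto
    qed
    from card_mono[OF _ this] show ?thesis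
      using card_image_le[of "{..<j}" w] by simp
  qed
qed

text \<open>The transposition reverses the order only of \<open>j\<close> and \<open>Suc j\<close>,
  which are not an inversion after the swap. So it carries a 321 pattern of the new permutation to
  one of \<open>w\<close>.\<close>

lemma avoids_321_descent:
  assumes av: "avoids_321 w" and desc: "w (Suc j) < w j"
  shows "avoids_321 (w \<circ> transpose j (Suc j))"
  unfolding avoids_321_def
proof
  let ?s = "transpose j (Suc j)"
  assume "\<exists>a b c. a < b \<and> b < c \<and> (w \<circ> ?s) b < (w \<circ> ?s) a \<and> (w \<circ> ?s) c < (w \<circ> ?s) b"
  then obtain a b c where *: "a < b" "b < c" "w (?s b) < w (?s a)" "w (?s c) < w (?s b)"
    by auto
  have "?s x < ?s y" if "x < y" "w (?s y) < w (?s x)" for x y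
  proof (rule ccontr)
    assume "\<not> ?s x < ?s y"
    then have "x = j" "y = Suc j"
      using that(1) by (auto simp: transpose_def split: if_splits)
    with that(2) desc show False by simp
  qed
  with * show False using av unfolding avoids_321_def by blast
qed


section \<open>Set-valued tableaux indexed by values and positions\<close>

text \<open>
  The row of the excedance \<open>p\<close> of \<open>w\<close> is labelled by the value \<open>v = w p\<close>, and its boxes from
  left to right by the indices \<open>v - 1, \<dots>, p\<close> of the simple reflections that they stand for. With
  these names the boxes of \<open>w s\<^sub>j\<close> for a descent \<open>j\<close> of \<open>w\<close> are boxes of \<open>w\<close>, even if a row
  disappears.
\<close>

definition boxes :: "(nat \<Rightarrow> nat) \<Rightarrow> (nat \<times> nat) set" where
  "boxes w = {(v, c). \<exists>p\<le>c. w p = v \<and> c < v}"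

text \<open>The second coordinate is the diagonal, which decreases to the right and increases
  downwards. The strict condition compares any two rows on consecutive diagonals, not only adjacent
  rows, so it needs no row numbers and survives the loss of a row. \<open>P\<close> lists the pairs
  of label and diagonal that have a factor.\<close>

definition ordered_labels :: "(nat \<times> nat) set \<Rightarrow> (nat \<times> nat \<Rightarrow> nat set) \<Rightarrow> bool" where
  "ordered_labels P T \<longleftrightarrow>
     (\<forall>v c. \<forall>k\<in>T (v, c). (k, c) \<in> P) \<and>
     (\<forall>v c. \<forall>k\<in>T (v, Suc c). \<forall>l\<in>T (v, c). k \<le> l) \<and>
     (\<forall>u v c. u < v \<longrightarrow> (\<forall>k\<in>T (u, c). \<forall>l\<in>T (v, Suc c). k < l))"

lemma ordered_labelsD:
  assumes "ordered_labels P T"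
  shows "k \<in> T (v, c) \<Longrightarrow> (k, c) \<in> P"
    and "k \<in> T (v, Suc c) \<Longrightarrow> l \<in> T (v, c) \<Longrightarrow> k \<le> l"
    and "u < v \<Longrightarrow> k \<in> T (u, c) \<Longrightarrow> l \<in> T (v, Suc c) \<Longrightarrow> k < l"
  using assms by (simp_all add: ordered_labels_def)

lemma ordered_labels_mono:
  assumes "ordered_labels P T" and "\<And>b. T' b \<subseteq> T b" and "\<And>k v c. k \<in> T' (v, c) \<Longrightarrow> (k, c) \<in> P'"
  shows "ordered_labels P' T'"
  using assms unfolding ordered_labels_def by (meson subsetD)

definition tableaux :: "(nat \<times> nat) set \<Rightarrow> (nat \<times> nat) set \<Rightarrow> (nat \<times> nat \<Rightarrow> nat set) set" where
  "tableaux P B = {T. {b. T b \<noteq> {}} = B \<and> ordered_labels P T}"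

text \<open>The excess of labels over boxes is counted box by box, so that changing one label
  changes one factor.\<close>

definition weight :: "'b set \<Rightarrow> ('b \<Rightarrow> nat set) \<Rightarrow> xpoly" where
  "weight B T = (\<Prod>b\<in>B. \<beta> ^ (card (T b) - 1) * (\<Prod>k\<in>T b. X k))"

definition tableaux_sum :: "(nat \<times> nat) set \<Rightarrow> (nat \<Rightarrow> nat) \<Rightarrow> xpoly" where
  "tableaux_sum P w = (\<Sum>T\<in>tableaux P (boxes w). weight (boxes w) T)"

lemma finite_boxes:
  assumes "w permutes {1..n}"
  shows "finite (boxes w)"
proof (rule finite_subset)
  show "boxes w \<subseteq> {..n} \<times> {..<n}"
  proof (clarsimp simp: boxes_def)
    fix p c assume "p \<le> c" "c < w p"
    then have "p \<in> {1..n}" using permutes_not_in[OF assms, of p] by auto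
    then have "w p \<in> {1..n}" using permutes_in_image[OF assms] by blast
    with \<open>c < w p\<close> show "w p \<le> n \<and> c < n" by simp
  qed
qed simp

lemma tableaux_label_subset: "T \<in> tableaux P B \<Longrightarrow> T b \<subseteq> fst ` P"
  using ordered_labelsD(1)[of P T _ "fst b" "snd b"] by (force simp: tableaux_def)

lemma finite_tableaux:
  assumes "finite P" "finite B"
  shows "finite (tableaux P B)"
proof (rule finite_subset)
  show "tableaux P B \<subseteq> {T. \<forall>b. (b \<in> B \<longrightarrow> T b \<in> Pow (fst ` P)) \<and> (b \<notin> B \<longrightarrow> T b = {})}"
    using tableaux_label_subset by (fastforce simp: tableaux_def)
  show "finite {T. \<forall>b. (b \<in> B \<longrightarrow> T b \<in> Pow (fst ` P)) \<and> (b \<notin> B \<longrightarrow> T b = {})}"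
    by (rule finite_set_of_finite_funs) (use assms in auto)
qed

text \<open>The value \<open>w j\<close> moves one position to the right, so its row loses the box
  on diagonal \<open>j\<close>. The value \<open>w (Suc j)\<close> is at most \<open>j\<close> and
  has no boxes at either position.\<close>

lemma boxes_descent:
  assumes "bij w" "avoids_321 w" "w (Suc j) < w j"
  shows "(w j, j) \<in> boxes w"
    and "boxes (w \<circ> transpose j (Suc j)) = boxes w - {(w j, j)}"
proof -
  note d = descent_321_avoiding[OF assms]
  have inj: "w p = w q \<longleftrightarrow> p = q" for p q
    using bij_is_inj[OF assms(1)] by (simp add: inj_eq)
  show "(w j, j) \<in> boxes w" using d by (auto simp: boxes_def)
  show "boxes (w \<circ> transpose j (Suc j)) = boxes w - {(w j, j)}"
  proof (intro equalityI subrelI)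
    fix v c assume "(v, c) \<in> boxes (w \<circ> transpose j (Suc j))"
    then obtain p where p: "p \<le> c" "w (transpose j (Suc j) p) = v" "c < v"
      by (auto simp: boxes_def)
    consider "p = j" | "p = Suc j" | "p \<noteq> j" "p \<noteq> Suc j" by blast
    then show "(v, c) \<in> boxes w - {(w j, j)}"
    proof cases
      case 1 with p d show ?thesis by simp
    next
      case 2 with p show ?thesis by (auto simp: boxes_def intro: exI[of _ j])
    next
      case 3 with p show ?thesis by (auto simp: boxes_def inj)
    qed
  next
    fix v c assume "(v, c) \<in> boxes w - {(w j, j)}"
    then obtain p where p: "p \<le> c" "w p = v" "c < v" "\<not> (v = w j \<and> c = j)"
      by (auto simp: boxes_def)
    consider "p = j" | "p = Suc j" | "p \<noteq> j" "p \<noteq> Suc j" by blast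
    then show "(v, c) \<in> boxes (w \<circ> transpose j (Suc j))"
    proof cases
      case 1 with p show ?thesis by (auto simp: boxes_def intro!: exI[of _ "Suc j"])
    next
      case 2 with p d show ?thesis by simp
    next
      case 3 with p show ?thesis by (auto simp: boxes_def intro!: exI[of _ p])
    qed
  qed
qed

text \<open>
  The hypothesis on \<open>P\<close> says that \<open>(k, j)\<close> comes after all of \<open>P\<close> in the order in which the
  factors of \<open>row_prod\<close> are multiplied.
\<close>

lemma last_label:
  assumes bij: "bij w" and P: "\<And>l c. (l, c) \<in> P \<Longrightarrow> l < k \<or> (l = k \<and> j < c)"
    and T: "T \<in> tableaux (insert (k, j) P) (boxes w)" and k: "k \<in> T (v, j)"
  shows "v = w j" and "w (Suc j) < w j"
proof -
  have ol: "ordered_labels (insert (k, j) P) T" using T by (simp add: tableaux_def)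
  have lab: "l < k \<or> (l = k \<and> j \<le> c)" if "l \<in> T (u, c)" for l u c
    using ordered_labelsD(1)[OF ol that] P by fastforce
  have supp: "T b \<noteq> {} \<longleftrightarrow> b \<in> boxes w" for b
    using T by (auto simp: tableaux_def)
  have hor: "l \<le> l'" if "l \<in> T (u, Suc c)" "l' \<in> T (u, c)" for l l' u c
    using ordered_labelsD(2)[OF ol that] .
  have ver: "l < l'" if "u < u'" "l \<in> T (u, c)" "l' \<in> T (u', Suc c)" for l l' u u' c
    using ordered_labelsD(3)[OF ol that] .
  have "(v, j) \<in> boxes w" using supp k by blast
  then obtain p where p: "p \<le> j" "w p = v" "j < v" by (auto simp: boxes_def)
  \<comment> \<open>Otherwise the row has a box further right, on diagonal \<open>j - 1\<close>. Its
    labels would have to be at least \<open>k\<close>, but on diagonals before \<open>j\<close> only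
    smaller labels are allowed.\<close>
  have "p = j"
  proof (rule ccontr)
    assume "p \<noteq> j"
    then obtain c where c: "j = Suc c" "p \<le> c" using p(1) by (cases j) auto
    then have "(v, c) \<in> boxes w" using p by (auto simp: boxes_def)
    then obtain l where l: "l \<in> T (v, c)" using supp by blast
    then show False using hor[of k v c l] k lab[of l v c] c by auto
  qed
  then show v: "v = w j" using p by simp
  \<comment> \<open>At an ascent there would be a box on diagonal \<open>Suc j\<close> with larger
    value, whose labels would have to exceed the largest label \<open>k\<close>.\<close>
  show "w (Suc j) < w j"
  proof (rule ccontr)
    assume "\<not> w (Suc j) < w j"
    moreover have "w (Suc j) \<noteq> w j" using bij_is_inj[OF bij] by (simp add: inj_eq)
    ultimately have less: "v < w (Suc j)" using v by simp
    then have "(w (Suc j), Suc j) \<in> boxes w" using p by (auto simp: boxes_def)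
    then obtain l where l: "l \<in> T (w (Suc j), Suc j)" using supp by blast
    then show False using ver[OF less k l] lab[OF l] by auto
  qed
qed

text \<open>No label exceeds \<open>k\<close>, and labels equal to \<open>k\<close> lie on diagonals
  beyond \<open>j\<close>, so only a box to the right of or below the corner could violate the
  order. The row of \<open>w j\<close> ends on diagonal \<open>j\<close>, and a row of larger value
  reaching diagonal \<open>Suc j\<close> would complete a 321 pattern with the descent.\<close>

lemma ordered_labels_insert_last:
  assumes bij: "bij w" and av: "avoids_321 w" and desc: "w (Suc j) < w j"
    and P: "\<And>l c. (l, c) \<in> P \<Longrightarrow> l < k \<or> (l = k \<and> j < c)"
    and supp: "{b. T b \<noteq> {}} \<subseteq> boxes w" and T: "ordered_labels P T"
  shows "ordered_labels (insert (k, j) P) (T((w j, j) := insert k (T (w j, j))))"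
proof -
  let ?T = "T((w j, j) := insert k (T (w j, j)))"
  have lab: "(l, c) \<in> P" if "l \<in> T (u, c)" for l u c
    using ordered_labelsD(1)[OF T that] .
  have hor: "l \<le> l'" if "l \<in> T (u, Suc c)" "l' \<in> T (u, c)" for l l' u c
    using ordered_labelsD(2)[OF T that] .
  have ver: "l < l'" if "u < u'" "l \<in> T (u, c)" "l' \<in> T (u', Suc c)" for l l' u u' c
    using ordered_labelsD(3)[OF T that] .
  have mem: "l \<in> ?T b \<longleftrightarrow> l \<in> T b \<or> (b = (w j, j) \<and> l = k)" for l b by auto
  have left: "T (w j, c) = {}" if "Suc c = j" for c
  proof (rule ccontr)
    assume "T (w j, c) \<noteq> {}"
    then obtain p where "p \<le> c" "w p = w j" using supp by (auto simp: boxes_def)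
    then show False using that bij_is_inj[OF bij] by (simp add: inj_eq)
  qed
  have below: "T (v, Suc j) = {}" if "w j < v" for v
  proof (rule ccontr)
    assume "T (v, Suc j) \<noteq> {}"
    then obtain p where p: "p \<le> Suc j" "w p = v" using supp by (auto simp: boxes_def)
    then have "p < j" using that desc by (metis le_SucE le_neq_implies_less less_asym less_irrefl)
    then show False using av that desc p unfolding avoids_321_def by blast
  qed
  show ?thesis
    unfolding ordered_labels_def mem
  proof (intro conjI allI ballI impI)
    fix v c l assume "l \<in> ?T (v, c)"
    then show "(l, c) \<in> insert (k, j) P" using lab unfolding mem by blast
  next
    fix v c l l' assume l: "l \<in> ?T (v, Suc c)" and l': "l' \<in> ?T (v, c)"
    show "l \<le> l'"
    proof (cases "l \<in> T (v, Suc c)")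
      case True
      then show ?thesis using l' hor[OF True] P[OF lab[OF True]] unfolding mem by auto
    next
      case False
      then have "v = w j" "Suc c = j" using l unfolding mem by auto
      then show ?thesis using l' left[of c] unfolding mem by auto
    qed
  next
    fix u v c l l' assume uv: "u < v" and l: "l \<in> ?T (u, c)" and l': "l' \<in> ?T (v, Suc c)"
    show "l < l'"
    proof (cases "l \<in> T (u, c)")
      case True
      then show ?thesis using l' ver[OF uv True] P[OF lab[OF True]] unfolding mem by auto
    next
      case False
      then have "u = w j" "c = j" using l unfolding mem by auto
      then show ?thesis using l' below[of v] uv unfolding mem by auto
    qed
  qed
qed

section \<open>Allowing one more pair of label and diagonal\<close>

lemma weight_insert_new:
  assumes "finite B" "b \<notin> B" "T b = {}"
  shows "weight (insert b B) (T(b := insert k (T b))) = X k * weight B T"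
proof -
  have "weight B (T(b := insert k (T b))) = weight B T"
    unfolding weight_def using assms(2) by (intro prod.cong) auto
  then show ?thesis using assms by (simp add: weight_def)
qed

lemma weight_insert_more:
  assumes "finite B" "b \<in> B" "T b \<noteq> {}" "finite (T b)" "k \<notin> T b"
  shows "weight B (T(b := insert k (T b))) = X k * (\<beta> * weight B T)"
proof -
  have eq: "(\<Prod>a\<in>B - {b}. \<beta> ^ (card ((T(b := insert k (T b))) a) - 1) * prod X ((T(b := insert k (T b))) a)) =
      (\<Prod>a\<in>B - {b}. \<beta> ^ (card (T a) - 1) * prod X (T a))"
    by (intro prod.cong) auto
  obtain m where "card (T b) = Suc m"
    using assms(3,4) by (metis card_gt_0_iff gr0_implies_Suc)
  then show ?thesis
    unfolding weight_def prod.remove[OF assms(1,2)] eq using assms by (simp add: algebra_simps)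
qed

text \<open>Delete \<open>k\<close> from the corner box. If it was the only label there, the box
  disappears, leaving a tableau for \<open>w \<circ> transpose j (Suc j)\<close> and the factor
  \<open>X k\<close>. Otherwise a tableau for \<open>w\<close> remains, with the factor
  \<open>X k * \<beta>\<close>. These are the two terms of \<open>hecke\<close>.\<close>

lemma tableaux_sum_insert:
  assumes w: "w permutes {1..n}" and av: "avoids_321 w" and fin: "finite P"
    and P: "\<And>l c. (l, c) \<in> P \<Longrightarrow> l < k \<or> (l = k \<and> j < c)"
  shows "tableaux_sum (insert (k, j) P) w = hfactor j (X k) (tableaux_sum P) w"
proof -
  let ?B = "boxes w" and ?b = "(w j, j)"
  let ?S = "tableaux P ?B" and ?S' = "tableaux (insert (k, j) P) ?B"
  let ?g = "\<lambda>T. T(?b := insert k (T ?b))"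
  have bij: "bij w" using w by (rule permutes_bij)
  have finB: "finite ?B" using w by (rule finite_boxes)
  have finS: "finite ?S" "finite ?S'" using fin finB by (auto intro: finite_tableaux)
  have notin: "(k, j) \<notin> P" using P by blast
  then have k_notin: "k \<notin> T (v, j)" if "T \<in> tableaux P B" for T B v
    using that ordered_labelsD(1)[of P T k v j] by (auto simp: tableaux_def)
  have sub: "?S \<subseteq> ?S'"
  proof
    fix T assume T: "T \<in> ?S"
    then have "ordered_labels P T" by (simp add: tableaux_def)
    then have "ordered_labels (insert (k, j) P) T"
      by (rule ordered_labels_mono) (auto dest: ordered_labelsD(1)[OF \<open>ordered_labels P T\<close>])
    then show "T \<in> ?S'" using T by (simp add: tableaux_def)
  qed
  have old: "T \<in> ?S" if "T \<in> ?S'" "\<And>v. k \<notin> T (v, j)" for T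
  proof -
    have T: "ordered_labels (insert (k, j) P) T" using that(1) by (simp add: tableaux_def)
    have "(l, c) \<in> P" if "l \<in> T (v, c)" for l v c
      using ordered_labelsD(1)[OF T that] \<open>\<And>v. k \<notin> T (v, j)\<close> that by blast
    then have "ordered_labels P T" by (rule ordered_labels_mono[OF T order_refl])
    then show ?thesis using that(1) by (simp add: tableaux_def)
  qed
  show ?thesis
  proof (cases "w (Suc j) < w j")
    case False
    then have "k \<notin> T (v, j)" if "T \<in> ?S'" for T v
      using last_label(2)[OF bij P] that by blast
    then have "?S' = ?S" using sub old by blast
    then show ?thesis using False by (simp add: tableaux_sum_def hfactor_def hecke_def)
  next
    case True
    let ?w = "w \<circ> transpose j (Suc j)"
    note b = boxes_descent[OF bij av True]
    let ?S1 = "tableaux P (boxes ?w)"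
    have finS1: "finite ?S1" using fin finB b(2) by (auto intro: finite_tableaux)
    have supp1: "T ?b = {}" if "T \<in> ?S1" for T
      using that unfolding tableaux_def b(2) by auto
    have supp: "T ?b \<noteq> {}" if "T \<in> ?S" for T
      using that b(1) unfolding tableaux_def by auto
    have disj: "?S1 \<inter> ?S = {}" using supp1 supp by blast
    have "(\<Sum>T\<in>?S' - ?S. weight ?B T) = (\<Sum>T\<in>?S1 \<union> ?S. weight ?B (?g T))"
    proof (rule sum.reindex_bij_witness[where i = ?g and j = "\<lambda>T. T(?b := T ?b - {k})"])
      fix T assume T: "T \<in> ?S' - ?S"
      then obtain v where "k \<in> T (v, j)" using old by blast
      then have k: "k \<in> T ?b" using last_label(1)[OF bij P] T by blast
      show "?g (T(?b := T ?b - {k})) = T" using k by (auto simp: fun_eq_iff)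
      have only: "v = w j" if "k \<in> T (v, j)" for v
        using last_label(1)[OF bij P] T that by blast
      have ol: "ordered_labels (insert (k, j) P) T" using T by (simp add: tableaux_def)
      have "(l, c) \<in> P" if "l \<in> (T(?b := T ?b - {k})) (v, c)" for l v c
        using ordered_labelsD(1)[OF ol, of l v c] only that by (auto split: if_splits)
      then have "ordered_labels P (T(?b := T ?b - {k}))"
        by (intro ordered_labels_mono[OF ol]) auto
      moreover have "{a. (T(?b := T ?b - {k})) a \<noteq> {}} = (if T ?b = {k} then ?B - {?b} else ?B)"
        using T k b(1) by (auto simp: tableaux_def)
      ultimately show "T(?b := T ?b - {k}) \<in> ?S1 \<union> ?S"
        unfolding tableaux_def b(2) by (auto split: if_splits)
      show "weight ?B (?g (T(?b := T ?b - {k}))) = weight ?B T"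
        using k by (simp add: insert_absorb)
    next
      fix T assume T: "T \<in> ?S1 \<union> ?S"
      then have k: "k \<notin> T ?b" using k_notin by blast
      then show "(?g T)(?b := (?g T) ?b - {k}) = T" by (auto simp: fun_eq_iff)
      have "{a. T a \<noteq> {}} \<subseteq> ?B" "ordered_labels P T"
        using T unfolding tableaux_def b(2) by auto
      then have "ordered_labels (insert (k, j) P) (?g T)"
        using ordered_labels_insert_last[OF bij av True P] by blast
      moreover have "{a. (?g T) a \<noteq> {}} = ?B"
        using T b(1) unfolding tableaux_def b(2) by auto
      ultimately have "?g T \<in> ?S'" by (simp add: tableaux_def)
      moreover have "?g T \<notin> ?S" using k_notin[of "?g T" ?B "w j"] by auto
      ultimately show "?g T \<in> ?S' - ?S" by blast
    qed
    also have "\<dots> = (\<Sum>T\<in>?S1. weight ?B (?g T)) + (\<Sum>T\<in>?S. weight ?B (?g T))"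
      by (rule sum.union_disjoint) (use finS finS1 disj in auto)
    also have "(\<Sum>T\<in>?S1. weight ?B (?g T)) = (\<Sum>T\<in>?S1. X k * weight (boxes ?w) T)"
    proof (rule sum.cong)
      fix T assume T: "T \<in> ?S1"
      have B: "?B = insert ?b (boxes ?w)" using b by auto
      have "weight (insert ?b (boxes ?w)) (?g T) = X k * weight (boxes ?w) T"
      proof (rule weight_insert_new)
        show "finite (boxes ?w)" "?b \<notin> boxes ?w" using finB by (simp_all add: b(2))
      qed (rule supp1[OF T])
      then show "weight ?B (?g T) = X k * weight (boxes ?w) T" by (simp only: B[symmetric])
    qed simp
    also have "(\<Sum>T\<in>?S. weight ?B (?g T)) = (\<Sum>T\<in>?S. X k * (\<beta> * weight ?B T))"
    proof (rule sum.cong)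
      fix T assume T: "T \<in> ?S"
      show "weight ?B (?g T) = X k * (\<beta> * weight ?B T)"
      proof (rule weight_insert_more)
        show "finite (T ?b)"
          using tableaux_label_subset[OF T] fin by (meson finite_imageI finite_subset)
      qed (use finB b(1) supp[OF T] k_notin[OF T] in auto)
    qed simp
    finally have "(\<Sum>T\<in>?S' - ?S. weight ?B T) =
      X k * (tableaux_sum P ?w + \<beta> * tableaux_sum P w)"
      by (simp only: tableaux_sum_def sum_distrib_left distrib_left)
    moreover have "(\<Sum>T\<in>?S'. weight ?B T) = (\<Sum>T\<in>?S' - ?S. weight ?B T) + (\<Sum>T\<in>?S. weight ?B T)"
      by (rule sum.subset_diff) (use sub finS in auto)
    ultimately show ?thesis
      using True by (simp add: tableaux_sum_def hfactor_def hecke_def)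
  qed
qed

lemma tableaux_sum_empty:
  assumes "w permutes {1..n}"
  shows "tableaux_sum {} w = (if w = id then 1 else 0)"
proof -
  have T: "tableaux {} B = (if B = {} then {\<lambda>_. {}} else {})" for B
    by (auto simp: tableaux_def ordered_labels_def fun_eq_iff)
  have "boxes w = {} \<longleftrightarrow> w = id"
  proof
    assume *: "boxes w = {}"
    have "w p \<le> p" for p
    proof (rule ccontr)
      assume "\<not> w p \<le> p"
      then have "(w p, p) \<in> boxes w" by (auto simp: boxes_def)
      with * show False by simp
    qed
    then show "w = id" using permutes_natset_le[OF assms] by blast
  qed (auto simp: boxes_def)
  then show ?thesis by (simp add: tableaux_sum_def T weight_def)
qed

lemma finite_label_pairs: "finite {(k, c). 1 \<le> k \<and> k \<le> c \<and> c < n \<and> Q k c}" for n :: nat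
  by (rule finite_subset[of _ "{..n} \<times> {..n}"]) auto

lemma row_prod_eq_tableaux_sum:
  assumes "m \<le> n" "w permutes {1..n}" "avoids_321 w"
  shows "row_prod n m w = tableaux_sum {(k, c). 1 \<le> k \<and> k \<le> c \<and> c < n \<and> k \<le> m} w"
  using assms
proof (induction m arbitrary: w)
  case 0
  have empty: "{(k, c). 1 \<le> k \<and> k \<le> c \<and> c < n \<and> k \<le> 0} = ({} :: (nat \<times> nat) set)" by auto
  show ?case unfolding empty using tableaux_sum_empty[OF 0(2)] by simp
next
  case (Suc m)
  \<comment> \<open>\<open>?P i\<close> collects the pairs of the factors multiplied so far when row
    \<open>Suc m\<close> has come down to the generator \<open>i\<close>.\<close>
  let ?P = "\<lambda>i. {(k, c). 1 \<le> k \<and> k \<le> c \<and> c < n \<and> (k \<le> m \<or> k = Suc m \<and> i \<le> c)}"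
  have "row n i (X (Suc m)) (row_prod n m) w = tableaux_sum (?P i) w"
    if "i \<le> n" "Suc m \<le> i" "w permutes {1..n}" "avoids_321 w" for i w
    using that
  proof (induction arbitrary: w rule: inc_induct)
    case base
    moreover have "?P n = {(k, c). 1 \<le> k \<and> k \<le> c \<and> c < n \<and> k \<le> m}" by auto
    ultimately show ?case using Suc.IH[of w] by simp
  next
    case (step i)
    have ins: "?P i = insert (Suc m, i) (?P (Suc i))" using step by auto
    have "tableaux_sum (insert (Suc m, i) (?P (Suc i))) w =
        hfactor i (X (Suc m)) (tableaux_sum (?P (Suc i))) w"
      by (rule tableaux_sum_insert[OF step.prems(2,3) finite_label_pairs]) auto
    also have "\<dots> = hfactor i (X (Suc m)) (row n (Suc i) (X (Suc m)) (row_prod n m)) w"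
    proof -
      have "row n (Suc i) (X (Suc m)) (row_prod n m) w = tableaux_sum (?P (Suc i)) w"
        using step by simp
      \<comment> \<open>\<open>hecke\<close> looks at the swapped permutation only at a descent, and
        there 321-avoidance is preserved.\<close>
      moreover have "row n (Suc i) (X (Suc m)) (row_prod n m) (w \<circ> transpose i (Suc i)) =
          tableaux_sum (?P (Suc i)) (w \<circ> transpose i (Suc i))" if "w (Suc i) < w i"
      proof (rule step.IH)
        show "w \<circ> transpose i (Suc i) permutes {1..n}"
          using step by (intro permutes_compose permutes_swap_id step.prems(2)) auto
        show "avoids_321 (w \<circ> transpose i (Suc i))"
          by (rule avoids_321_descent[OF step.prems(3) that])
      qed (use step in simp)
      ultimately show ?thesis by (simp add: hfactor_def hecke_def)
    qed
    finally show ?case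
      unfolding ins row_unfold[OF step.hyps(2)] by (rule sym)
  qed
  from this[of "Suc m" w] Suc.prems
  have "row_prod n (Suc m) w = tableaux_sum (?P (Suc m)) w" by simp
  also have "?P (Suc m) = {(k, c). 1 \<le> k \<and> k \<le> c \<and> c < n \<and> k \<le> Suc m}" by auto
  finally show ?case .
qed


section \<open>Transfer to the flagged skew shape\<close>

text \<open>If \<open>w a\<close> were larger, every value below \<open>w b\<close> would stand
  before position \<open>b\<close>, as otherwise it would complete a 321 pattern. Then
  \<open>w b \<le> b\<close> by counting.\<close>

lemma excedances_increasing:
  assumes bij: "bij w" and av: "avoids_321 w" and "b < w b" "a < b"
  shows "w a < w b"
proof (rule ccontr)
  assume "\<not> w a < w b"
  moreover have "w a \<noteq> w b" using bij_is_inj[OF bij] assms(4) by (simp add: inj_eq)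
  ultimately have gt: "w b < w a" by simp
  have "{..<w b} \<subseteq> w ` {..<b}"
  proof
    fix v assume v: "v \<in> {..<w b}"
    obtain p where p: "v = w p" using bij by (metis bij_pointE)
    have "\<not> b < p" using av gt v assms(4) unfolding avoids_321_def p by (metis lessThan_iff)
    moreover have "p \<noteq> b" using v p by auto
    ultimately show "v \<in> w ` {..<b}" using p by auto
  qed
  from card_mono[OF _ this] have "w b \<le> b"
    using card_image_le[of "{..<b}" w] by simp
  with assms(3) show False by simp
qed

section \<open>Weights of tableaux as monomials\<close>

lemma monomial_add: "monomial (m + m') = monomial m * monomial m'"
  by (simp add: monomial_def mult_single)

lemma monomial_zero: "monomial 0 = 1"
  by (simp add: monomial_def)

lemma monomial_sum: "monomial (\<Sum>a\<in>A. m a) = (\<Prod>a\<in>A. monomial (m a))"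
  by (induction A rule: infinite_finite_induct) (simp_all add: monomial_add monomial_zero)

text \<open>Double counting of pairs of a box and one of its labels gives the total degree as the
  sum of the label sizes. As labels are nonempty, the truncated subtractions are exact.\<close>

lemma weight_eq_monomial:
  assumes D: "finite D" and T: "T \<in> SVT D"
  shows "weight D T = \<beta> ^ (total_degree (exponents D T) - card D) * monomial (exponents D T)"
proof -
  have fin: "finite (T b)" "T b \<noteq> {}" if "b \<in> D" for b
    using T that by (auto simp: SVT_def)
  have indicator: "card {b \<in> D. x \<in> T b} = (\<Sum>b\<in>D. if x \<in> T b then 1 else 0)" for x
    using D by (simp flip: sum.inter_filter)
  have "exponents D T = (\<Sum>b\<in>D. \<Sum>k\<in>T b. Poly_Mapping.single k 1)"
  proof (rule poly_mapping_eqI)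
    fix x
    have "Poly_Mapping.lookup (\<Sum>b\<in>D. \<Sum>k\<in>T b. Poly_Mapping.single k (1::nat)) x =
        (\<Sum>b\<in>D. \<Sum>k\<in>T b. if k = x then 1 else 0)"
      by (simp add: lookup_sum lookup_single when_def del: One_nat_def)
    also have "\<dots> = (\<Sum>b\<in>D. if x \<in> T b then 1 else 0)"
      using fin by (intro sum.cong) auto
    finally show "Poly_Mapping.lookup (exponents D T) x =
        Poly_Mapping.lookup (\<Sum>b\<in>D. \<Sum>k\<in>T b. Poly_Mapping.single k (1::nat)) x"
      by (simp add: lookup_exponents[OF D T] indicator)
  qed
  then have monom: "monomial (exponents D T) = (\<Prod>b\<in>D. \<Prod>k\<in>T b. X k)"
    by (simp add: monomial_sum X_def)
  let ?A = "\<Union>b\<in>D. T b"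
  have "total_degree (exponents D T) = (\<Sum>x\<in>?A. Poly_Mapping.lookup (exponents D T) x)"
    unfolding total_degree_def
  proof (rule sum.mono_neutral_left)
    show "finite ?A" using D fin by simp
    show "Poly_Mapping.keys (exponents D T) \<subseteq> ?A"
    proof
      fix x assume "x \<in> Poly_Mapping.keys (exponents D T)"
      then have "card {b \<in> D. x \<in> T b} \<noteq> 0"
        by (simp add: in_keys_iff lookup_exponents[OF D T])
      then have "{b \<in> D. x \<in> T b} \<noteq> {}" by (metis card.empty)
      then show "x \<in> ?A" by blast
    qed
  qed (simp add: in_keys_iff)
  also have "\<dots> = (\<Sum>b\<in>D. \<Sum>x\<in>?A. if x \<in> T b then 1 else 0)"
    unfolding lookup_exponents[OF D T] indicator by (rule sum.swap)
  also have "\<dots> = (\<Sum>b\<in>D. card (T b))"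
  proof (rule sum.cong)
    fix b assume b: "b \<in> D"
    have "(\<Sum>x\<in>?A. if x \<in> T b then 1 else 0) = card {x \<in> ?A. x \<in> T b}"
      using D fin by (simp flip: sum.inter_filter)
    also have "{x \<in> ?A. x \<in> T b} = T b" using b by auto
    finally show "(\<Sum>x\<in>?A. if x \<in> T b then 1 else 0) = card (T b)" .
  qed simp
  also have "\<dots> - card D = (\<Sum>b\<in>D. card (T b) - 1)"
  proof -
    have "1 \<le> card (T b)" if "b \<in> D" for b
      using fin[OF that] by (simp add: Suc_le_eq card_gt_0_iff)
    then have "(\<Sum>b\<in>D. card (T b) - 1) = (\<Sum>b\<in>D. card (T b)) - (\<Sum>b\<in>D. 1)"
      by (intro sum_subtractf_nat) auto
    then show ?thesis by simp
  qed
  finally show ?thesis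
    unfolding monom weight_def by (simp add: power_sum prod.distrib)
qed

section \<open>The bijection between flagged tableaux of the skew shape and tableaux on the named
  boxes\<close>

locale perm_321_avoiding =
  fixes n :: nat and w :: "nat \<Rightarrow> nat"
  assumes perm: "w permutes {1..n}" and avoids: "avoids_321 w"
begin

lemma bij: "bij w"
  using perm by (rule permutes_bij)

lemma finite_excedances: "finite {j. j < w j}"
  by (rule finite_subset[of _ "{1..n}"]) (use permutes_not_in[OF perm] in force)+

lemma set_excedances: "set (excedances w) = {j. j < w j}"
  using finite_excedances by (simp add: excedances_def)

lemma flag_excedance:
  assumes "i \<in> {1..num_rows w}"
  shows "flag w i < w (flag w i)"
proof -
  have "flag w i \<in> set (excedances w)"
    unfolding flag_def by (rule nth_mem) (use assms in \<open>auto simp: num_rows_def\<close>)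
  then show ?thesis by (simp add: set_excedances)
qed

lemma obtain_row:
  assumes "p < w p"
  obtains i where "i \<in> {1..num_rows w}" "flag w i = p"
proof -
  have "p \<in> set (excedances w)" using assms set_excedances by simp
  then obtain m where "m < length (excedances w)" "excedances w ! m = p"
    by (auto simp: in_set_conv_nth)
  then show ?thesis by (intro that[of "Suc m"]) (auto simp: flag_def num_rows_def)
qed

lemma flag_less:
  assumes "1 \<le> i" "i < i'" "i' \<le> num_rows w"
  shows "flag w i < flag w i'"
proof -
  have "sorted_wrt (<) (excedances w)"
    unfolding excedances_def by (rule strict_sorted_list_of_set)
  then show ?thesis
    using assms by (auto simp: flag_def num_rows_def sorted_wrt_iff_nth_less)
qed

lemma value_less:
  assumes "1 \<le> i" "i < i'" "i' \<le> num_rows w"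
  shows "w (flag w i) < w (flag w i')"
  using excedances_increasing[OF bij avoids flag_excedance flag_less] assms by auto

text \<open>
  Moving right by one column lowers the index \<open>box_index\<close> of a box by one and moving down by one
  row raises it by one; the last box of row \<open>i\<close> has index \<open>flag w i\<close>.
\<close>

definition box_index :: "nat \<Rightarrow> int \<Rightarrow> int" where
  "box_index i j = lam w 1 + int i - j"

definition relabel :: "nat \<times> int \<Rightarrow> nat \<times> nat" where
  "relabel = (\<lambda>(i, j). (w (flag w i), nat (box_index i j)))"

lemma mem_skew_shape:
  "(i, j) \<in> skew_shape w \<longleftrightarrow> i \<in> {1..num_rows w} \<and> int (flag w i) \<le> box_index i j \<and>
     box_index i j < int (w (flag w i))"
proof (cases "i \<in> {1..num_rows w}")
  case True
  then have "lam w (num_rows w + 1 - i) = int (w (flag w i)) - int i"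
    "mu w (num_rows w + 1 - i) = int (flag w i) - int i"
    by (simp_all add: lam_def mu_def p_seq_def q_seq_def e_seq_def)
  then have "eta w i = lam w 1 + int i - int (flag w i)"
    "tau w i = lam w 1 + int i - int (w (flag w i))"
    by (simp_all only: eta_def tau_def)
  then show ?thesis using True
    by (auto simp: skew_shape_def skew_diagram_def box_index_def)
qed (auto simp: skew_shape_def skew_diagram_def)

lemma inj_on_relabel: "inj_on relabel (skew_shape w)"
proof (rule inj_onI, clarify)
  fix i j i' j' assume ij: "(i, j) \<in> skew_shape w" and ij': "(i', j') \<in> skew_shape w"
    and eq: "relabel (i, j) = relabel (i', j')"
  have i: "i \<in> {1..num_rows w}" "i' \<in> {1..num_rows w}" "w (flag w i) = w (flag w i')"
    "nat (box_index i j) = nat (box_index i' j')" "0 \<le> box_index i j" "0 \<le> box_index i' j'"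
    using ij ij' eq unfolding mem_skew_shape relabel_def by auto
  then have "i = i'"
    using value_less[of i i'] value_less[of i' i] by (cases i i' rule: linorder_cases) auto
  moreover have "box_index i j = box_index i' j'" using i(4-6) by simp
  ultimately show "i = i' \<and> j = j'" by (simp add: box_index_def)
qed

lemma relabel_image: "relabel ` skew_shape w = boxes w"
proof (intro equalityI subsetI)
  fix b assume "b \<in> relabel ` skew_shape w"
  then obtain i j where "(i, j) \<in> skew_shape w" "b = relabel (i, j)" by auto
  then show "b \<in> boxes w"
    unfolding mem_skew_shape relabel_def boxes_def
    by (auto intro!: exI[of _ "flag w i"])
next
  fix b assume "b \<in> boxes w"
  then obtain p c where b: "b = (w p, c)" "p \<le> c" "c < w p" by (auto simp: boxes_def)
  then obtain i where i: "i \<in> {1..num_rows w}" "flag w i = p"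
    using obtain_row[of p] by auto
  let ?j = "lam w 1 + int i - int c"
  have "(i, ?j) \<in> skew_shape w" "relabel (i, ?j) = b"
    using i b by (auto simp: mem_skew_shape relabel_def box_index_def)
  then show "b \<in> relabel ` skew_shape w" by force
qed

lemma finite_skew_shape: "finite (skew_shape w)"
  unfolding skew_shape_def by (rule finite_skew_diagram)

text \<open>This supplies the strict condition of \<open>ordered_labels\<close> for rows that need
  not be adjacent: walk alternately one box down and one box right, ending with a step down.\<close>

lemma FSVT_less:
  assumes T: "T \<in> FSVT (skew_shape w) (flag w)"
    and "(i, j) \<in> skew_shape w" "(i + d + 1, j + int d) \<in> skew_shape w"
    and "k \<in> T (i, j)" "l \<in> T (i + d + 1, j + int d)"
  shows "k < l"
  using assms(2-)
proof (induction d arbitrary: i j k)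
  case 0
  then have "Max (T (i, j)) < Min (T (i + 1, j))" "finite (T (i, j))" "finite (T (i + 1, j))"
    using T by (auto simp: FSVT_def SVT_def)
  moreover have "k \<le> Max (T (i, j))" "Min (T (i + 1, j)) \<le> l"
    using 0 calculation by auto
  ultimately show ?case by simp
next
  case (Suc d)
  have rows: "1 \<le> i" "i + Suc d + 1 \<le> num_rows w"
    using Suc.prems(1,2) by (auto simp: mem_skew_shape)
  \<comment> \<open>Strictly increasing flags and values keep the intermediate boxes inside the
    shape.\<close>
  have "flag w (i + 1) < flag w (i + Suc d + 1)" "w (flag w i) < w (flag w (i + 1))"
    using rows by (auto intro: flag_less value_less)
  then have mem: "(i + 1, j) \<in> skew_shape w" "(i + 1, j + 1) \<in> skew_shape w"
    using Suc.prems(1,2) by (auto simp: mem_skew_shape box_index_def)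
  have T': "Max (T (i, j)) < Min (T (i + 1, j))" "finite (T (i, j))" "finite (T (i + 1, j))"
    "Max (T (i + 1, j)) \<le> Min (T (i + 1, j + 1))" "finite (T (i + 1, j + 1))"
    "T (i + 1, j) \<noteq> {}" "T (i + 1, j + 1) \<noteq> {}"
    using T Suc.prems(1) mem by (auto simp: FSVT_def SVT_def)
  have "k \<le> Max (T (i, j))" using Suc.prems(3) T' by simp
  also have "\<dots> < Min (T (i + 1, j))" using T' by simp
  also have "\<dots> \<le> Max (T (i + 1, j))" using T' by (meson Min_le Max_in)
  also have "\<dots> \<le> Min (T (i + 1, j + 1))" using T' by simp
  also have "\<dots> < l"
  proof (rule Suc.IH[of "i + 1" "j + 1"])
    show "Min (T (i + 1, j + 1)) \<in> T (i + 1, j + 1)" using T' by simp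
  qed (use mem Suc.prems in \<open>simp_all add: algebra_simps\<close>)
  finally show ?case .
qed

definition label_pairs :: "(nat \<times> nat) set" where
  "label_pairs = {(k, c). 1 \<le> k \<and> k \<le> c \<and> c < n \<and> k \<le> n}"

lemma finite_fst_label_pairs: "finite (fst ` label_pairs)"
  unfolding label_pairs_def by (intro finite_imageI finite_label_pairs)

definition push :: "(nat \<times> int \<Rightarrow> nat set) \<Rightarrow> nat \<times> nat \<Rightarrow> nat set" where
  "push T = (\<lambda>b. if b \<in> boxes w then T (inv_into (skew_shape w) relabel b) else {})"

definition pull :: "(nat \<times> nat \<Rightarrow> nat set) \<Rightarrow> nat \<times> int \<Rightarrow> nat set" where
  "pull T = (\<lambda>b. if b \<in> skew_shape w then T (relabel b) else {})"

lemma push_relabel: "b \<in> skew_shape w \<Longrightarrow> push T (relabel b) = T b"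
  using relabel_image inj_on_relabel by (auto simp: push_def)

lemma mem_push:
  assumes "k \<in> push T b"
  obtains i j where "(i, j) \<in> skew_shape w" "b = relabel (i, j)" "k \<in> T (i, j)"
proof -
  have "b \<in> boxes w" using assms by (auto simp: push_def split: if_splits)
  then obtain a where "a \<in> skew_shape w" "b = relabel a" using relabel_image by blast
  moreover have "k \<in> T a" using assms calculation push_relabel by simp
  ultimately show ?thesis by (cases a) (auto intro: that)
qed

lemma push_in_tableaux:
  assumes T: "T \<in> FSVT (skew_shape w) (flag w)"
  shows "push T \<in> tableaux label_pairs (boxes w)"
proof -
  have SVT: "finite (T b)" "T b \<noteq> {}" "\<And>k. k \<in> T b \<Longrightarrow> 1 \<le> k" if "b \<in> skew_shape w" for b
    using T that unfolding FSVT_def SVT_def by blast+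
  have flagged: "T (i, j) \<subseteq> {1..flag w i}" if "(i, j) \<in> skew_shape w" for i j
    using T that unfolding FSVT_def by blast
  have "{b. push T b \<noteq> {}} = boxes w"
  proof (intro equalityI subsetI)
    fix b assume "b \<in> boxes w"
    then obtain a where "a \<in> skew_shape w" "b = relabel a" using relabel_image by blast
    then show "b \<in> {b. push T b \<noteq> {}}" using push_relabel SVT(2) by simp
  qed (auto simp: push_def split: if_splits)
  moreover have "ordered_labels label_pairs (push T)"
    unfolding ordered_labels_def
  proof (intro conjI allI ballI impI)
    fix v c k assume "k \<in> push T (v, c)"
    then obtain i j where ij: "(i, j) \<in> skew_shape w" "(v, c) = relabel (i, j)" "k \<in> T (i, j)"
      by (rule mem_push)
    have k: "1 \<le> k" "k \<le> flag w i" using flagged[OF ij(1)] ij(3) by auto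
    have c: "flag w i \<le> c" "c < w (flag w i)"
      using ij(1,2) by (auto simp: mem_skew_shape relabel_def)
    have "flag w i \<in> {1..n}" using c permutes_not_in[OF perm, of "flag w i"] by auto
    then have "w (flag w i) \<le> n" using permutes_in_image[OF perm] by (metis atLeastAtMost_iff)
    then show "(k, c) \<in> label_pairs" using k c by (simp add: label_pairs_def)
  next
    fix v c k l assume "k \<in> push T (v, Suc c)" "l \<in> push T (v, c)"
    then obtain i j i' j' where ij: "(i, j) \<in> skew_shape w" "(v, Suc c) = relabel (i, j)" "k \<in> T (i, j)"
      and ij': "(i', j') \<in> skew_shape w" "(v, c) = relabel (i', j')" "l \<in> T (i', j')"
      by (metis mem_push)
    have rows: "i \<in> {1..num_rows w}" "i' \<in> {1..num_rows w}" "w (flag w i) = w (flag w i')"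
      and idx: "box_index i j = int (Suc c)" "box_index i' j' = int c"
      using ij(1,2) ij'(1,2) unfolding mem_skew_shape relabel_def by auto
    have i': "i' = i" using rows value_less[of i i'] value_less[of i' i]
      by (cases i i' rule: linorder_cases) auto
    then have j': "j' = j + 1" using idx by (simp add: box_index_def)
    have "Max (T (i, j)) \<le> Min (T (i, j + 1))"
      using T ij(1) ij'(1) unfolding i' j' FSVT_def SVT_def by blast
    then show "k \<le> l"
      using ij(3) ij'(3) SVT(1)[OF ij(1)] SVT(1)[OF ij'(1)] unfolding i' j'
      by (meson Max_ge Min_le order_trans)
  next
    fix u v c k l assume uv: "u < v" and "k \<in> push T (u, c)" "l \<in> push T (v, Suc c)"
    then obtain i j i' j' where ij: "(i, j) \<in> skew_shape w" "(u, c) = relabel (i, j)" "k \<in> T (i, j)"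
      and ij': "(i', j') \<in> skew_shape w" "(v, Suc c) = relabel (i', j')" "l \<in> T (i', j')"
      by (metis mem_push)
    have rows: "i \<in> {1..num_rows w}" "i' \<in> {1..num_rows w}" "w (flag w i) < w (flag w i')"
      and idx: "box_index i j = int c" "box_index i' j' = int (Suc c)"
      using ij(1,2) ij'(1,2) uv unfolding mem_skew_shape relabel_def by auto
    have "i < i'" using rows value_less[of i' i]
      by (cases i i' rule: linorder_cases) auto
    then obtain d where i': "i' = i + d + 1" using less_imp_Suc_add by force
    then have j': "j' = j + int d" using idx by (simp add: box_index_def)
    show "k < l" using FSVT_less[OF T ij(1) _ ij(3)] ij'(1,3) unfolding i' j' by blast
  qed
  ultimately show ?thesis by (simp add: tableaux_def)
qed

lemma pull_in_FSVT:
  assumes T: "T \<in> tableaux label_pairs (boxes w)"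
  shows "pull T \<in> FSVT (skew_shape w) (flag w)"
proof -
  have ol: "ordered_labels label_pairs T" and supp: "\<And>b. T b \<noteq> {} \<longleftrightarrow> b \<in> boxes w"
    using T unfolding tableaux_def by auto
  have fin: "finite (T b)" for b
    using tableaux_label_subset[OF T] finite_fst_label_pairs by (rule finite_subset)
  have box: "relabel b \<in> boxes w" if "b \<in> skew_shape w" for b
    using that relabel_image by blast
  \<comment> \<open>Labels weakly increase towards the last box of the row, on the diagonal
    \<open>p\<close>. There \<open>label_pairs\<close> bounds them by \<open>p\<close>, so the
    diagonal bound yields the flag bound for the whole row.\<close>
  have first: "\<exists>l\<in>T (w p, p). k \<le> l" if "p \<le> c" "c < w p" "k \<in> T (w p, c)" for p c k
    using that
  proof (induction arbitrary: k rule: dec_induct)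
    case (step c)
    have "(w p, c) \<in> boxes w" using step by (auto simp: boxes_def)
    then obtain m where m: "m \<in> T (w p, c)" using supp by blast
    then have "k \<le> m" using ordered_labelsD(2)[OF ol step.prems(2)] by blast
    then show ?case using step.IH[OF _ m] step.prems(1) by (meson Suc_lessD order_trans)
  qed blast
  have flagged: "1 \<le> k \<and> k \<le> flag w i" if "(i, j) \<in> skew_shape w" "k \<in> T (relabel (i, j))" for i j k
  proof -
    let ?p = "flag w i" and ?c = "nat (box_index i j)"
    have c: "?p \<le> ?c" "?c < w ?p" "k \<in> T (w ?p, ?c)"
      using that by (auto simp: mem_skew_shape relabel_def)
    then obtain l where "l \<in> T (w ?p, ?p)" "k \<le> l" using first by blast
    moreover from this have "l \<le> ?p" using ordered_labelsD(1)[OF ol] by (force simp: label_pairs_def)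
    moreover have "1 \<le> k" using ordered_labelsD(1)[OF ol c(3)] by (simp add: label_pairs_def)
    ultimately show ?thesis by simp
  qed
  have Max_Min: "Max (T a) \<in> T a" "Min (T a) \<in> T a" if "a \<in> boxes w" for a
    using that fin supp by simp_all
  have hor: "Max (T (relabel (i, j))) \<le> Min (T (relabel (i, j + 1)))"
    if "(i, j) \<in> skew_shape w" "(i, j + 1) \<in> skew_shape w" for i j
  proof -
    have "relabel (i, j) = (w (flag w i), Suc (nat (box_index i (j + 1))))"
      "relabel (i, j + 1) = (w (flag w i), nat (box_index i (j + 1)))"
      using that by (auto simp: relabel_def box_index_def mem_skew_shape)
    then show ?thesis
      using ordered_labelsD(2)[OF ol] Max_Min(1)[OF box[OF that(1)]] Max_Min(2)[OF box[OF that(2)]]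
      by metis
  qed
  have ver: "Max (T (relabel (i, j))) < Min (T (relabel (i + 1, j)))"
    if "(i, j) \<in> skew_shape w" "(i + 1, j) \<in> skew_shape w" for i j
  proof -
    have "relabel (i, j) = (w (flag w i), nat (box_index i j))"
      "relabel (i + 1, j) = (w (flag w (i + 1)), Suc (nat (box_index i j)))"
      using that by (auto simp: relabel_def box_index_def mem_skew_shape)
    moreover have "w (flag w i) < w (flag w (i + 1))"
      using that by (intro value_less) (auto simp: mem_skew_shape)
    ultimately show ?thesis
      using ordered_labelsD(3)[OF ol] Max_Min(1)[OF box[OF that(1)]] Max_Min(2)[OF box[OF that(2)]]
      by metis
  qed
  show ?thesis
    unfolding FSVT_def SVT_def pull_def using flagged hor ver fin supp box by auto
qed

lemma sum_weight_FSVT: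
  "(\<Sum>T\<in>FSVT (skew_shape w) (flag w). weight (skew_shape w) T) = tableaux_sum label_pairs w"
  unfolding tableaux_sum_def
proof (rule sum.reindex_bij_witness[where i = pull and j = push])
  fix T assume T: "T \<in> FSVT (skew_shape w) (flag w)"
  have "T b = {}" if "b \<notin> skew_shape w" for b
    using T that unfolding FSVT_def SVT_def by blast
  then show "pull (push T) = T" by (auto simp: pull_def push_relabel fun_eq_iff)
  show "push T \<in> tableaux label_pairs (boxes w)" using T by (rule push_in_tableaux)
  show "weight (boxes w) (push T) = weight (skew_shape w) T"
    unfolding weight_def relabel_image[symmetric] prod.reindex[OF inj_on_relabel]
    by (intro prod.cong) (simp_all add: push_relabel)
next
  fix T assume T: "T \<in> tableaux label_pairs (boxes w)"
  show "pull T \<in> FSVT (skew_shape w) (flag w)" using T by (rule pull_in_FSVT)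
  show "push (pull T) = T"
  proof
    fix b
    show "push (pull T) b = T b"
    proof (cases "b \<in> boxes w")
      case True
      then obtain a where "a \<in> skew_shape w" "b = relabel a" using relabel_image by blast
      then show ?thesis by (simp add: push_relabel pull_def)
    next
      case False
      then show ?thesis using T unfolding tableaux_def push_def by auto
    qed
  qed
qed

end

theorem corollary6p5:
  fixes n :: nat and w :: "nat \<Rightarrow> nat"
  assumes "w permutes {1..n}" and "avoids_321 w"
  shows "grothendieck n w =
    (\<Sum>T\<in>FSVT (skew_shape w) (flag w).
       \<beta> ^ (total_degree (exponents (skew_shape w) T) - card (skew_shape w)) *
       monomial (exponents (skew_shape w) T))"
proof -
  interpret perm_321_avoiding n w by unfold_locales (fact assms)+
  have "grothendieck n w = tableaux_sum label_pairs w"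
    using grothendieck_eq_row_prod[OF assms(1)] row_prod_eq_tableaux_sum[OF order_refl assms]
    by (simp add: label_pairs_def)
  also have "\<dots> = (\<Sum>T\<in>FSVT (skew_shape w) (flag w). weight (skew_shape w) T)"
    by (rule sum_weight_FSVT[symmetric])
  also have "\<dots> = (\<Sum>T\<in>FSVT (skew_shape w) (flag w).
       \<beta> ^ (total_degree (exponents (skew_shape w) T) - card (skew_shape w)) *
       monomial (exponents (skew_shape w) T))"
    using weight_eq_monomial[OF finite_skew_shape] by (intro sum.cong) (auto simp: FSVT_def)
  finally show ?thesis .
qed

end
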